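(* Let $V$ be a complex vector space of dimension $n$ and let $r\geq 1$ be an integer with $2r<n$. Let $X\subset\mathbb G(r,V)$ be a suitable variety, and let $\overline X\subset\mathbb P\,\mathrm{Hom}(\mathbb C^r,V)$ be the closure of $\pi^{-1}(X)$. Then $X^Q=\pi'\big[(\overline X)^*\big]$, where $(\overline X)^*\subset\mathbb P\,\mathrm{Hom}(V,\mathbb C^r)$ is the usual projective dual variety of $\overline X\subset\mathbb P\,\mathrm{Hom}(\mathbb C^r,V)$.
   Context: $\mathbb G(r,V)$ is the Grassmannian of $r$-dimensional subspaces of $V$; $\mathbb G(r,V^* )$ is viewed as the variety of codimension $r$ subspaces of $V$. For $x\in\mathbb G(r,V)$, $L_x\subset V$ is the corresponding subspace. $T_x\mathbb G(r,V)=\mathrm{Hom}(L_x,V/L_x)$ and $T_x^*\mathbb G(r,V)=\mathrm{Hom}(V/L_x,L_x)$ (trace pairing). A cotangent form $\varphi\in\mathrm{Hom}(V/L_x,L_x)$ is \emph{generic} if it has rank $r$; then $q(\varphi)\in\mathbb G(r,V^* )$ is the kernel of the composition $V\to V/L_x\xrightarrow{\varphi}L_x$, a codimension $r$ subspace of $V$. For a closed irreducible $X\subset\mathbb G(r,V)$, $N^*X$ is the conormal bundle of the smooth locus of $X$; $X$ is \emph{suitable} if $N^*X$ contains generic forms, and then its dual variety $X^Q\subset\mathbb G(r,V^* )$ is the closure of $\{q(\varphi):\varphi\in N^*X\text{ generic}\}$. $\pi:\mathbb P\,\mathrm{Hom}(\mathbb C^r,V)\dashrightarrow\mathbb G(r,V)$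 maps the class of a map of rank $r$ to its image; $\pi':\mathbb P\,\mathrm{Hom}(V,\mathbb C^r)\dashrightarrow\mathbb G(r,V^* )$ maps the class of a map of rank $r$ to its kernel. $\mathrm{Hom}(V,\mathbb C^r)$ is identified with the dual of $\mathrm{Hom}(\mathbb C^r,V)$ by $(g,h)\mapsto\mathrm{tr}(g\circ h)$. The image of a variety under a rational map is the closure of the image of the locus where the map is defined. The usual dual variety $Z^*\subset\mathbb P W^*$ of $Z\subset\mathbb P W$ is the closure of the set of hyperplanes containing the embedded tangent space of $Z$ at some smooth point. *)

theory Defs
  imports "HOL-Analysis.Analysis"
begin

text \<open>
  The vector space V is \<open>complex^'n\<close>, with \<open>n = CARD('n)\<close>, and \<open>C^r\<close> is \<open>complex^'r\<close>. A linear map is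
  its matrix, so Hom(C^r,V) is \<open>complex^'r^'n\<close>, Hom(V,C^r) is \<open>complex^'n^'r\<close> and End(V) is
  \<open>complex^'n^'n\<close>. Complex linear subspaces are those of the library interpretation \<open>vec\<close>
  (the constants \<open>subspace\<close>, \<open>dim\<close> of HOL are the real ones).
\<close>

inductive poly_fun :: "(complex^'m^'k \<Rightarrow> complex) \<Rightarrow> bool" where
  const: "poly_fun (\<lambda>A. c)"
| entry: "poly_fun (\<lambda>A. A $ i $ j)"
| add: "poly_fun f \<Longrightarrow> poly_fun g \<Longrightarrow> poly_fun (\<lambda>A. f A + g A)"
| mult: "poly_fun f \<Longrightarrow> poly_fun g \<Longrightarrow> poly_fun (\<lambda>A. f A * g A)"

definition zariski :: "(complex^'m^'k) topology" where
  "zariski = topology (\<lambda>U. \<exists>S. (\<forall>f\<in>S. poly_fun f) \<and> U = {A. \<exists>f\<in>S. f A \<noteq> 0})"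

text \<open>
  For polynomial \<open>f\<close> the real Frechet derivative is complex linear, and it is the usual
  differential of \<open>f\<close>.
\<close>

definition differential :: "(complex^'m^'k \<Rightarrow> complex) \<Rightarrow> complex^'m^'k \<Rightarrow> complex^'m^'k \<Rightarrow> complex" where
  "differential f A = frechet_derivative f (at A)"

definition tangent_space :: "(complex^'m^'k) set \<Rightarrow> complex^'m^'k \<Rightarrow> (complex^'m^'k) set" where
  "tangent_space S A =
     {v. \<forall>f. poly_fun f \<and> (\<forall>B\<in>S. f B = 0) \<longrightarrow> differential f A v = 0}"

text \<open>
  \<open>A\<close> is a smooth point of \<open>S\<close> if, on a Zariski neighbourhood of \<open>A\<close>, the set \<open>S\<close> is cut out by
  polynomials whose differentials at \<open>A\<close> are linearly independent (as a family indexed by \<open>F\<close>).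
\<close>

definition smooth_point :: "(complex^'m^'k) set \<Rightarrow> complex^'m^'k \<Rightarrow> bool" where
  "smooth_point S A \<longleftrightarrow> A \<in> S \<and>
     (\<exists>U F. openin zariski U \<and> A \<in> U \<and> finite F \<and> (\<forall>f\<in>F. poly_fun f) \<and>
        S \<inter> U = {B \<in> U. \<forall>f\<in>F. f B = 0} \<and>
        (\<forall>c::(complex^'m^'k \<Rightarrow> complex) \<Rightarrow> complex.
           (\<forall>v. (\<Sum>f\<in>F. c f * differential f A v) = 0) \<longrightarrow> (\<forall>f\<in>F. c f = 0)))"

definition irreducible_in :: "'a topology \<Rightarrow> 'a set \<Rightarrow> bool" where
  "irreducible_in T S \<longleftrightarrow> S \<noteq> {} \<and>
     (\<forall>C D. closedin T C \<and> closedin T D \<and> S \<subseteq> C \<union> D \<longrightarrow> S \<subseteq> C \<or> S \<subseteq> D)"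

definition cscale :: "complex \<Rightarrow> complex^'m^'k \<Rightarrow> complex^'m^'k" where
  "cscale c A = (\<chi> i j. c * A $ i $ j)"

text \<open>A point of projective space is the line spanned by a nonzero matrix.\<close>

definition proj_class :: "complex^'m^'k \<Rightarrow> (complex^'m^'k) set" where
  "proj_class A = range (\<lambda>c. cscale c A)"

definition proj_space :: "(complex^'m^'k) set set" where
  "proj_space = proj_class ` {A. A \<noteq> 0}"

definition hom_poly :: "(complex^'m^'k \<Rightarrow> complex) \<Rightarrow> bool" where
  "hom_poly f \<longleftrightarrow> poly_fun f \<and> (\<exists>d. \<forall>c A. f (cscale c A) = c ^ d * f A)"

definition proj_zariski :: "(complex^'m^'k) set topology" where
  "proj_zariski = topology
     (\<lambda>U. \<exists>S. (\<forall>f\<in>S. hom_poly f) \<and> U = proj_class ` {A. A \<noteq> 0 \<and> (\<exists>f\<in>S. f A \<noteq> 0)})"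

definition affine_cone :: "(complex^'m^'k) set set \<Rightarrow> (complex^'m^'k) set" where
  "affine_cone Z = {A. A = 0 \<or> proj_class A \<in> Z}"

text \<open>
  A point \<open>[A]\<close> of \<open>Z\<close> is smooth iff the affine cone is smooth at \<open>A\<close>, and the embedded tangent
  space there is the projectivization of the tangent space of the cone at \<open>A\<close>. Via
  \<open>(g, h) \<mapsto> trace (g ** h)\<close>, the class of a nonzero \<open>g\<close> is a hyperplane.
\<close>

definition proj_dual :: "(complex^'m^'k) set set \<Rightarrow> (complex^'k^'m) set set" where
  "proj_dual Z = proj_zariski closure_of
     {proj_class g | g. g \<noteq> 0 \<and>
        (\<exists>h. h \<noteq> 0 \<and> smooth_point (affine_cone Z) h \<and>
             (\<forall>v \<in> tangent_space (affine_cone Z) h. trace (g ** v) = 0))}"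

definition grass :: "nat \<Rightarrow> (complex^'n) set set" where
  "grass k = {L. vec.subspace L \<and> vec.dim L = k}"

definition complementary :: "(complex^'n) set \<Rightarrow> (complex^'n) set \<Rightarrow> bool" where
  "complementary L W \<longleftrightarrow> vec.subspace L \<and> vec.subspace W \<and> L \<inter> W = {0} \<and>
     (\<forall>v. \<exists>l\<in>L. \<exists>w\<in>W. v = l + w)"

text \<open>
  If V is the direct sum of \<open>L\<close> and \<open>W\<close>, then Hom(L,W) is realized inside End(V) as the maps that
  vanish on \<open>W\<close> and have image in \<open>W\<close>. Sending a map to its graph gives the standard affine chart of
  the Grassmannian with origin \<open>L\<close>.
\<close>

definition chart_space :: "(complex^'n) set \<Rightarrow> (complex^'n) set \<Rightarrow> (complex^'n^'n) set" where
  "chart_space L W = {A. (\<forall>v. A *v v \<in> W) \<and> (\<forall>w\<in>W. A *v w = 0)}"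

definition chart :: "(complex^'n) set \<Rightarrow> complex^'n^'n \<Rightarrow> (complex^'n) set" where
  "chart L A = (\<lambda>l. l + A *v l) ` L"

definition in_chart ::
    "(complex^'n) set set \<Rightarrow> (complex^'n) set \<Rightarrow> (complex^'n) set \<Rightarrow> (complex^'n^'n) set" where
  "in_chart X L W = {A \<in> chart_space L W. chart L A \<in> X}"

text \<open>
  The variety of codimension \<open>r\<close> subspaces of V, i.e. the Grassmannian of \<open>r\<close>-dimensional
  subspaces of the dual of V, is \<open>grass (CARD('n) - r)\<close> with this topology.
\<close>

definition grass_zariski :: "nat \<Rightarrow> (complex^'n) set topology" where
  "grass_zariski k = topology (\<lambda>U. U \<subseteq> grass k \<and>
     (\<forall>L W. L \<in> grass k \<and> complementary L W \<longrightarrow>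
        openin (subtopology zariski (chart_space L W)) (in_chart U L W)))"

text \<open>
  Smoothness and the tangent space are read off in the chart centred at \<open>L\<close>; they do not depend on
  the complement \<open>W\<close>, nor on regarding the chart as a linear subspace of End(V).
\<close>

definition smooth_gr :: "(complex^'n) set set \<Rightarrow> (complex^'n) set \<Rightarrow> bool" where
  "smooth_gr X L \<longleftrightarrow> (\<exists>W. complementary L W \<and> smooth_point (in_chart X L W) 0)"

text \<open>
  A tangent vector of the Grassmannian at \<open>L\<close> is an element of Hom(L,V/L); here it is represented by
  any endomorphism of V inducing it, so \<open>tangent_gr X L\<close> is the preimage of the tangent space of \<open>X\<close>
  under the surjection from End(V) to Hom(L,V/L).
\<close>

definition tangent_gr :: "(complex^'n) set set \<Rightarrow> (complex^'n) set \<Rightarrow> (complex^'n^'n) set" where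
  "tangent_gr X L = {T. \<exists>W. complementary L W \<and>
     (\<exists>A \<in> tangent_space (in_chart X L W) 0. \<forall>l\<in>L. T *v l - A *v l \<in> L)}"

text \<open>
  A cotangent form in Hom(V/L,L) is identified with the composition of V \<open>\<rightarrow>\<close> V/L, the form and the
  inclusion of \<open>L\<close>: an endomorphism \<open>\<phi>\<close> of V that vanishes on \<open>L\<close> and has image in \<open>L\<close>. The trace of
  \<open>\<phi> ** T\<close> on V is then the trace pairing of the form with the tangent vector induced by \<open>T\<close>.
\<close>

definition conormal :: "(complex^'n) set set \<Rightarrow> ((complex^'n) set \<times> (complex^'n^'n)) set" where
  "conormal X = {(L, \<phi>). L \<in> X \<and> smooth_gr X L \<and>
     (\<forall>l\<in>L. \<phi> *v l = 0) \<and> (\<forall>v. \<phi> *v v \<in> L) \<and>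
     (\<forall>T \<in> tangent_gr X L. trace (\<phi> ** T) = 0)}"

definition map_rank :: "complex^'m^'k \<Rightarrow> nat" where
  "map_rank A = vec.dim (range (\<lambda>v. A *v v))"

definition kernel :: "complex^'m^'k \<Rightarrow> (complex^'m) set" where
  "kernel A = {v. A *v v = 0}"

definition suitable :: "nat \<Rightarrow> (complex^'n) set set \<Rightarrow> bool" where
  "suitable r X \<longleftrightarrow> closedin (grass_zariski r) X \<and> irreducible_in (grass_zariski r) X \<and>
     (\<exists>L \<phi>. (L, \<phi>) \<in> conormal X \<and> map_rank \<phi> = r)"

definition dual_Q :: "nat \<Rightarrow> (complex^'n) set set \<Rightarrow> (complex^'n) set set" where
  "dual_Q r X = grass_zariski (CARD('n) - r) closure_of
     {kernel \<phi> | L \<phi>. (L, \<phi>) \<in> conormal X \<and> map_rank \<phi> = r}"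

definition pi_preimage :: "(complex^'n) set set \<Rightarrow> (complex^'r^'n) set set" where
  "pi_preimage X =
     {proj_class h | h. map_rank h = CARD('r) \<and> range (\<lambda>v. h *v v) \<in> X}"

definition pi'_image :: "(complex^'n^'r) set set \<Rightarrow> (complex^'n) set set" where
  "pi'_image Z = grass_zariski (CARD('n) - CARD('r)) closure_of
     {kernel g | g. map_rank g = CARD('r) \<and> proj_class g \<in> Z}"

lemma openin_zariski:
  "openin zariski U \<longleftrightarrow> (\<exists>S. (\<forall>f\<in>S. poly_fun f) \<and> U = {A. \<exists>f\<in>S. f A \<noteq> 0})"
proof -
  have "istopology (\<lambda>U::(complex^'m^'k) set. \<exists>S. (\<forall>f\<in>S. poly_fun f) \<and> U = {A. \<exists>f\<in>S. f A \<noteq> 0})"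
    unfolding istopology_def
  proof (intro conjI allI impI)
    fix U V :: "(complex^'m^'k) set"
    assume U: "\<exists>S. (\<forall>f\<in>S. poly_fun f) \<and> U = {A. \<exists>f\<in>S. f A \<noteq> 0}"
      and V: "\<exists>S. (\<forall>f\<in>S. poly_fun f) \<and> V = {A. \<exists>f\<in>S. f A \<noteq> 0}"
    obtain S where S: "\<forall>f\<in>S. poly_fun f" "U = {A. \<exists>f\<in>S. f A \<noteq> 0}"
      using U by (elim exE conjE)
    obtain T where T: "\<forall>f\<in>T. poly_fun f" "V = {A. \<exists>f\<in>T. f A \<noteq> 0}"
      using V by (elim exE conjE)
    let ?P = "{(\<lambda>A. f A * g A) | f g. f \<in> S \<and> g \<in> T}"
    have "U \<inter> V = {A. \<exists>h\<in>?P. h A \<noteq> 0}"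
      unfolding S(2) T(2) by fastforce
    moreover have "\<forall>h\<in>?P. poly_fun h"
      using S T by (auto intro: poly_fun.mult)
    ultimately show "\<exists>S. (\<forall>f\<in>S. poly_fun f) \<and> U \<inter> V = {A. \<exists>f\<in>S. f A \<noteq> 0}"
      by blast
  next
    fix K :: "(complex^'m^'k) set set"
    assume "\<forall>U\<in>K. \<exists>S. (\<forall>f\<in>S. poly_fun f) \<and> U = {A. \<exists>f\<in>S. f A \<noteq> 0}"
    from bchoice[OF this] obtain S
      where S: "\<forall>U\<in>K. (\<forall>f\<in>S U. poly_fun f) \<and> U = {A. \<exists>f\<in>S U. f A \<noteq> 0}" ..
    then have "\<Union>K = (\<Union>U\<in>K. {A. \<exists>f\<in>S U. f A \<noteq> 0})"
      by (metis (no_types, lifting) SUP_cong image_ident)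
    also have "\<dots> = {A. \<exists>f\<in>\<Union>(S ` K). f A \<noteq> 0}"
      by blast
    finally have "\<Union>K = {A. \<exists>f\<in>\<Union>(S ` K). f A \<noteq> 0}" .
    moreover have "\<forall>f\<in>\<Union>(S ` K). poly_fun f"
      using S by simp
    ultimately show "\<exists>S. (\<forall>f\<in>S. poly_fun f) \<and> \<Union>K = {A. \<exists>f\<in>S. f A \<noteq> 0}"
      by (intro exI conjI)
  qed
  then show ?thesis
    unfolding zariski_def by (subst topology_inverse') (assumption, rule refl)
qed

lemma topspace_zariski [simp]: "topspace zariski = UNIV"
proof -
  have "openin zariski (UNIV :: (complex^'m^'k) set)"
    unfolding openin_zariski by (rule exI[of _ "{\<lambda>A. 1}"]) (auto intro: poly_fun.const)
  then show ?thesis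
    using openin_subset by blast
qed

lemma cscale_eq_mult: "cscale c (cscale d A) = cscale (c * d) A"
  by (simp add: cscale_def vec_eq_iff mult.assoc)

lemma cscale_one [simp]: "cscale 1 A = A"
  by (simp add: cscale_def vec_eq_iff)

lemma cscale_zero [simp]: "cscale 0 A = 0"
  by (simp add: cscale_def vec_eq_iff)

lemma proj_class_eq:
  assumes "proj_class A = proj_class B" "A \<noteq> 0"
  obtains c where "c \<noteq> 0" "A = cscale c B"
proof -
  have "A \<in> proj_class A"
    unfolding proj_class_def by (rule range_eqI[of _ _ 1]) simp
  then obtain c where "A = cscale c B"
    using assms(1) by (auto simp: proj_class_def)
  with assms(2) that show thesis by (metis cscale_zero)
qed

lemma hom_poly_nonzero_class:
  assumes "proj_class A = proj_class B" "A \<noteq> 0" "hom_poly f" "f A \<noteq> 0"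
  shows "f B \<noteq> 0"
  using assms by (metis hom_poly_def mult_zero_right proj_class_eq)

lemma hom_poly_mult:
  assumes "hom_poly f" "hom_poly g"
  shows "hom_poly (\<lambda>A. f A * g A)"
proof -
  from assms obtain d e where "\<And>c A. f (cscale c A) = c ^ d * f A" "\<And>c A. g (cscale c A) = c ^ e * g A"
    by (auto simp: hom_poly_def)
  then have "\<forall>c A. f (cscale c A) * g (cscale c A) = c ^ (d + e) * (f A * g A)"
    by (simp add: power_add mult_ac)
  moreover have "poly_fun (\<lambda>A. f A * g A)"
    using assms by (simp add: hom_poly_def poly_fun.mult)
  ultimately show ?thesis
    unfolding hom_poly_def by blast
qed

lemma openin_proj_zariski:
  "openin proj_zariski U \<longleftrightarrow>
     (\<exists>S. (\<forall>f\<in>S. hom_poly f) \<and> U = proj_class ` {A. A \<noteq> 0 \<and> (\<exists>f\<in>S. f A \<noteq> 0)})"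
proof -
  let ?O = "\<lambda>S. proj_class ` {A::complex^'m^'k. A \<noteq> 0 \<and> (\<exists>f\<in>S. f A \<noteq> 0)}"
  have "istopology (\<lambda>U. \<exists>S. (\<forall>f\<in>S. hom_poly f) \<and> U = ?O S)"
    unfolding istopology_def
  proof (intro conjI allI impI)
    fix U V :: "(complex^'m^'k) set set"
    assume U: "\<exists>S. (\<forall>f\<in>S. hom_poly f) \<and> U = ?O S" and V: "\<exists>S. (\<forall>f\<in>S. hom_poly f) \<and> V = ?O S"
    obtain S where S: "\<forall>f\<in>S. hom_poly f" "U = ?O S"
      using U by (elim exE conjE)
    obtain T where T: "\<forall>f\<in>T. hom_poly f" "V = ?O T"
      using V by (elim exE conjE)
    let ?P = "{(\<lambda>A. f A * g A) | f g. f \<in> S \<and> g \<in> T}"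
    have "U \<inter> V \<subseteq> ?O ?P"
    proof
      fix p assume "p \<in> U \<inter> V"
      then have "p \<in> ?O S" "p \<in> ?O T"
        by (simp_all add: S T)
      then obtain A B f g where *: "p = proj_class A" "A \<noteq> 0" "f \<in> S" "f A \<noteq> 0"
        "p = proj_class B" "B \<noteq> 0" "g \<in> T" "g B \<noteq> 0"
        by blast
      then have "g A \<noteq> 0"
        using T by (metis hom_poly_nonzero_class)
      with * have "f A * g A \<noteq> 0" "(\<lambda>A. f A * g A) \<in> ?P"
        by auto
      then have "\<exists>h\<in>?P. h A \<noteq> 0"
        by (intro bexI[of _ "\<lambda>A. f A * g A"]) auto
      with * show "p \<in> ?O ?P"
        by (intro image_eqI[of _ _ A]) auto
    qed
    moreover have "?O ?P \<subseteq> U \<inter> V"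
      unfolding S(2) T(2) by (intro subsetI IntI; elim imageE; clarsimp; blast)
    ultimately have "U \<inter> V = ?O ?P" ..
    moreover have "\<forall>f\<in>?P. hom_poly f"
      using S(1) T(1) by (auto intro: hom_poly_mult)
    ultimately show "\<exists>S. (\<forall>f\<in>S. hom_poly f) \<and> U \<inter> V = ?O S"
      by (intro exI conjI)
  next
    fix K :: "(complex^'m^'k) set set set"
    assume "\<forall>U\<in>K. \<exists>S. (\<forall>f\<in>S. hom_poly f) \<and> U = ?O S"
    from bchoice[OF this] obtain S
      where S: "\<forall>U\<in>K. (\<forall>f\<in>S U. hom_poly f) \<and> U = ?O (S U)" ..
    then have "\<Union>K = (\<Union>U\<in>K. ?O (S U))"
      by (metis (no_types, lifting) SUP_cong image_ident)
    also have "\<dots> = ?O (\<Union>(S ` K))"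
      by blast
    finally have "\<Union>K = ?O (\<Union>(S ` K))" .
    moreover have "\<forall>f\<in>\<Union>(S ` K). hom_poly f"
      using S by simp
    ultimately show "\<exists>S. (\<forall>f\<in>S. hom_poly f) \<and> \<Union>K = ?O S"
      by (intro exI conjI)
  qed
  then show ?thesis
    unfolding proj_zariski_def by (subst topology_inverse') (assumption, rule refl)
qed

lemma topspace_proj_zariski [simp]: "topspace proj_zariski = proj_space"
proof -
  have "hom_poly (\<lambda>A::complex^'m^'k. 1)"
    unfolding hom_poly_def by (intro conjI poly_fun.const exI[of _ 0]) simp
  then have "openin proj_zariski (proj_space :: (complex^'m^'k) set set)"
    unfolding openin_proj_zariski proj_space_def by (intro exI[of _ "{\<lambda>A. 1}"]) auto
  moreover have "U \<subseteq> proj_space" if "openin proj_zariski U" for U :: "(complex^'m^'k) set set"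
    using that by (auto simp: openin_proj_zariski proj_space_def)
  ultimately show ?thesis
    unfolding topspace_def by blast
qed

lemma openin_grass_zariski:
  "openin (grass_zariski k) U \<longleftrightarrow> U \<subseteq> grass k \<and>
     (\<forall>L W. L \<in> grass k \<and> complementary L W \<longrightarrow>
        openin (subtopology zariski (chart_space L W)) (in_chart U L W))"
proof -
  have Int: "in_chart (U \<inter> V) L W = in_chart U L W \<inter> in_chart V L W"
    and Un: "in_chart (\<Union>K) L W = \<Union>((\<lambda>U. in_chart U L W) ` K)"
    for U V K and L W :: "(complex^'n) set"
    by (auto simp: in_chart_def)
  have "istopology (\<lambda>U. U \<subseteq> grass k \<and>
     (\<forall>L W :: (complex^'n) set. L \<in> grass k \<and> complementary L W \<longrightarrow>
        openin (subtopology zariski (chart_space L W)) (in_chart U L W)))"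
    unfolding istopology_def Int Un by (auto intro!: openin_Int openin_Union)
  then show ?thesis
    unfolding grass_zariski_def by (subst topology_inverse') (assumption, rule refl)
qed

lemma chart_in_grass:
  assumes "L \<in> grass k" "complementary L W" "A \<in> chart_space L W"
  shows "chart L A \<in> grass k"
proof -
  have L: "vec.subspace L" "vec.dim L = k"
    using assms(1) by (auto simp: grass_def)
  let ?f = "(*v) (mat 1 + A)"
  have f: "chart L A = ?f ` L"
    by (simp add: chart_def matrix_vector_mult_add_rdistrib)
  have lin: "Vector_Spaces.linear (*s) (*s) ?f"
    by (rule matrix_vector_mul_linear_gen)
  have "x = 0" if "x \<in> L" "?f x = 0" for x
  proof -
    have "x = - (A *v x)"
      using that(2) by (simp add: matrix_vector_mult_add_rdistrib eq_neg_iff_add_eq_0)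
    moreover have "- (A *v x) \<in> W"
      using assms by (simp add: complementary_def chart_space_def vec.subspace_neg)
    ultimately show ?thesis
      using assms(2) that(1) by (auto simp: complementary_def)
  qed
  then have inj: "inj_on ?f L"
    using vec.linear_inj_on_iff_eq_0[OF lin L(1)] by blast
  moreover have "vec.span L = L"
    using L(1) by (simp add: vec.span_eq_iff)
  ultimately have "vec.dim (?f ` L) = vec.dim L"
    by (intro vec.dim_image_eq[OF lin]) (simp only:)
  moreover have "vec.subspace (?f ` L)"
    using vec.linear_subspace_image[OF lin L(1)] .
  ultimately show ?thesis
    using L by (simp add: f grass_def)
qed

lemma topspace_grass_zariski [simp]:
  "topspace (grass_zariski k :: (complex^'n) set topology) = grass k"
proof -
  have "in_chart (grass k) L W = chart_space L W"
    if "L \<in> grass k" "complementary L W" for L W :: "(complex^'n) set"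
    using chart_in_grass[OF that] by (auto simp: in_chart_def)
  then have "openin (grass_zariski k) (grass k :: (complex^'n) set set)"
    unfolding openin_grass_zariski
    by (metis inf_top_left openin_topspace order_refl topspace_subtopology topspace_zariski)
  then show ?thesis
    unfolding topspace_def using openin_grass_zariski by blast
qed

end

theory Submission
  imports Defs "HOL-Computational_Algebra.Polynomial"
begin

text \<open>
  Everything is compared in the space of matrices \<open>h : C\<^sup>r \<rightarrow> V\<close>. Let \<open>P\<close> be the set of those of rank \<open>r\<close>
  with image in \<open>X\<close> (\<open>frames X\<close>). Its Zariski closure is the affine cone over the closure of
  \<open>\<pi>\<^sup>-\<^sup>1(X)\<close> (\<open>affine_cone_closure_pi_preimage\<close>), and its points of rank \<open>r\<close> are those of \<open>P\<close>, as \<open>X\<close> is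
  closed (\<open>frames_closed\<close>).

  Over frames there is a dictionary. The tangent space of the cone at a frame \<open>h\<close> of \<open>L\<close> contains all
  matrices with image in \<open>L\<close>, so a form \<open>g\<close> that annihilates it vanishes on \<open>L\<close>, and \<open>\<phi> = h g\<close> is a
  cotangent form of the Grassmannian at \<open>L\<close> with the same kernel and rank as \<open>g\<close>. If the cone is smooth
  at \<open>h\<close>, then \<open>X\<close> is smooth at \<open>L\<close> and \<open>\<phi>\<close> is conormal to \<open>X\<close> (\<open>conormal_of_cone\<close>); each conormal
  form of \<open>X\<close> arises as \<open>h g\<close> (\<open>conormal_lifts_to_cone\<close>).

  The dual variety of the cone involves, however, smooth points of lower rank and a closure, and the
  \<open>g\<close> belonging to a conormal form of \<open>X\<close> may sit at an \<open>h\<close> that is not yet known to be a smooth point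
  of the cone. Both difficulties disappear by moving \<open>h\<close>. A form that annihilates a Zariski tangent
  space is the differential of one polynomial \<open>q\<close> that vanishes on the cone (\<open>conormal_is_gradient\<close>),
  so it extends to the family of the differentials of \<open>q\<close>, which is conormal at all points of the cone
  and depends polynomially on the point. The cone is irreducible, because \<open>X\<close> is and because the frames
  of one subspace form a copy of the general linear group (\<open>prime_locus_frames\<close>), and its smooth points
  are dense (\<open>generic_smoothness\<close>). Hence every open condition on the form that holds somewhere on the
  cone holds at a smooth point of \<open>P\<close> (\<open>perturb_conormal\<close>).

  For a generic conormal form \<open>\<phi> = h g\<close> of \<open>X\<close> this shows that \<open>g\<close> is in the dual variety of the cone, so
  that the kernel of \<open>\<phi>\<close> is that of a point of the dual variety. Conversely, let \<open>g\<close> of rank \<open>r\<close> be in the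
  dual variety, and let \<open>U\<close> be a neighbourhood of its kernel. Having rank \<open>r\<close> and kernel in \<open>U\<close> is an
  open condition on forms (\<open>kernel_continuous\<close>), which therefore holds for a form conormal to the cone at
  a smooth frame; by the dictionary \<open>U\<close> contains the kernel of a generic conormal form of \<open>X\<close>.
\<close>

section \<open>Polynomial functions and polynomial maps of matrices\<close>

lemma poly_fun_uminus: "poly_fun f \<Longrightarrow> poly_fun (\<lambda>A. - f A)"
  using poly_fun.mult[OF poly_fun.const[of "-1"]] by simp

lemma poly_fun_diff: "poly_fun f \<Longrightarrow> poly_fun g \<Longrightarrow> poly_fun (\<lambda>A. f A - g A)"
  using poly_fun.add[OF _ poly_fun_uminus] by simp

lemma poly_fun_sum:
  "(\<And>i. i \<in> I \<Longrightarrow> poly_fun (f i)) \<Longrightarrow> poly_fun (\<lambda>A. \<Sum>i\<in>I. f i A)"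
  by (induction I rule: infinite_finite_induct) (auto intro: poly_fun.intros)

lemma poly_fun_prod:
  "(\<And>i. i \<in> I \<Longrightarrow> poly_fun (f i)) \<Longrightarrow> poly_fun (\<lambda>A. \<Prod>i\<in>I. f i A)"
  by (induction I rule: infinite_finite_induct) (auto intro: poly_fun.intros)

lemma poly_fun_power: "poly_fun f \<Longrightarrow> poly_fun (\<lambda>A. f A ^ d)"
  by (induction d) (auto intro: poly_fun.intros)

lemmas poly_fun_intros = poly_fun.intros poly_fun_uminus poly_fun_diff poly_fun_sum poly_fun_prod
  poly_fun_power

definition poly_map :: "(complex^'m^'k \<Rightarrow> complex^'p^'q) \<Rightarrow> bool" where
  "poly_map N \<longleftrightarrow> (\<forall>i j. poly_fun (\<lambda>A. N A $ i $ j))"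

lemma poly_fun_compose:
  assumes "poly_fun f" "poly_map N"
  shows "poly_fun (\<lambda>A. f (N A))"
  using assms(1) by induction (use assms(2) in \<open>auto simp: poly_map_def intro: poly_fun.intros\<close>)

lemma poly_map_const: "poly_map (\<lambda>A. B)"
  by (simp add: poly_map_def poly_fun.const)

lemma poly_map_id: "poly_map (\<lambda>A. A)"
  by (simp add: poly_map_def poly_fun.entry)

lemma poly_map_add: "poly_map M \<Longrightarrow> poly_map N \<Longrightarrow> poly_map (\<lambda>A. M A + N A)"
  by (simp add: poly_map_def poly_fun.add)

lemma poly_map_diff: "poly_map M \<Longrightarrow> poly_map N \<Longrightarrow> poly_map (\<lambda>A. M A - N A)"
  by (simp add: poly_map_def poly_fun_diff)

lemma poly_map_uminus: "poly_map M \<Longrightarrow> poly_map (\<lambda>A. - M A)"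
  by (simp add: poly_map_def poly_fun_uminus)

lemma poly_map_mult: "poly_map M \<Longrightarrow> poly_map N \<Longrightarrow> poly_map (\<lambda>A. M A ** N A)"
  by (simp add: poly_map_def matrix_matrix_mult_def poly_fun_sum poly_fun.mult)

lemma poly_fun_det: "poly_map M \<Longrightarrow> poly_fun (\<lambda>A. det (M A))"
  unfolding det_def poly_map_def by (intro poly_fun_intros) auto

definition adjugate :: "complex^'m^'m \<Rightarrow> complex^'m^'m" where
  "adjugate A = (\<chi> k l. det (\<chi> i j. if j = k then (if i = l then 1 else 0) else A $ i $ j))"

lemma mult_adjugate:
  assumes "det A \<noteq> 0"
  shows "A ** cscale (1 / det A) (adjugate A) = mat 1"
proof -
  let ?B = "cscale (1 / det A) (adjugate A)"
  have "column l (A ** ?B) = axis l 1" for l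
  proof -
    have "column l ?B = (\<chi> k. det (\<chi> i j. if j = k then axis l 1 $ i else A $ i $ j) / det A)"
      by (simp add: vec_eq_iff column_def cscale_def adjugate_def axis_def eq_commute if_distrib cong: if_cong)
    then have "A *v column l ?B = axis l 1"
      using cramer[OF assms] by blast
    then show ?thesis
      by (simp add: column_def matrix_vector_mult_def matrix_matrix_mult_def vec_eq_iff)
  qed
  then have "(A ** ?B) $ i $ l = mat 1 $ i $ l" for i l
    by (metis (no_types, lifting) axis_def column_def mat_def vec_lambda_beta)
  then show ?thesis
    by (simp add: vec_eq_iff)
qed

lemma poly_fun_if:
  "(c \<Longrightarrow> poly_fun f) \<Longrightarrow> (\<not> c \<Longrightarrow> poly_fun g) \<Longrightarrow> poly_fun (\<lambda>A. if c then f A else g A)"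
  by (cases c) simp_all

lemma poly_map_adjugate:
  assumes "poly_map M"
  shows "poly_map (\<lambda>A. adjugate (M A))"
  unfolding poly_map_def adjugate_def
  using assms by (auto simp: poly_map_def if_distrib[of "\<lambda>x. poly_fun x"] intro!: poly_fun_det poly_fun_if poly_fun.const)

lemmas poly_map_intros = poly_map_const poly_map_id poly_map_add poly_map_diff poly_map_uminus
  poly_map_mult poly_map_adjugate

text \<open>
  The charts of the Grassmannian have rational coordinates, with one determinant as common
  denominator. Multiplying by a power of that determinant turns a polynomial in such coordinates
  into a polynomial with the same zeros on the open set where the determinant does not vanish.
\<close>

lemma clear_denominator:
  assumes "poly_fun f" "poly_map N" "poly_fun s"
  shows "\<exists>e q. poly_fun q \<and> (\<forall>A. s A \<noteq> 0 \<longrightarrow> q A = s A ^ e * f (cscale (1 / s A) (N A)))"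
  using assms(1)
proof induction
  case (const c)
  show ?case by (intro exI[of _ 0] exI[of _ "\<lambda>A. c"]) (auto intro: poly_fun.const)
next
  case (entry i j)
  show ?case
    using assms(2) by (intro exI[of _ 1] exI[of _ "\<lambda>A. N A $ i $ j"]) (auto simp: poly_map_def cscale_def)
next
  case (add f g)
  then obtain d p e q where *: "poly_fun p" "\<forall>A. s A \<noteq> 0 \<longrightarrow> p A = s A ^ d * f (cscale (1 / s A) (N A))"
    "poly_fun q" "\<forall>A. s A \<noteq> 0 \<longrightarrow> q A = s A ^ e * g (cscale (1 / s A) (N A))"
    by blast
  show ?case
    by (rule exI[of _ "d + e"], rule exI[of _ "\<lambda>A. s A ^ e * p A + s A ^ d * q A"])
      (use * assms(3) in \<open>auto simp: power_add algebra_simps intro!: poly_fun_intros\<close>)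
next
  case (mult f g)
  then obtain d p e q where *: "poly_fun p" "\<forall>A. s A \<noteq> 0 \<longrightarrow> p A = s A ^ d * f (cscale (1 / s A) (N A))"
    "poly_fun q" "\<forall>A. s A \<noteq> 0 \<longrightarrow> q A = s A ^ e * g (cscale (1 / s A) (N A))"
    by blast
  show ?case
    by (rule exI[of _ "d + e"], rule exI[of _ "\<lambda>A. p A * q A"])
      (use * assms(3) in \<open>auto simp: power_add algebra_simps intro!: poly_fun_intros\<close>)
qed

section \<open>Polynomials on lines, homogeneous components and differentials\<close>

text \<open>
  The expansion \<open>f (A + t B) = \<Sum>\<^sub>k c\<^sub>k(A, B) t\<^sup>k\<close> is stated with the type of univariate polynomials, so
  that root counting applies. Its coefficients give homogeneous components (\<open>A = 0\<close>) and the
  expansion with respect to one coordinate (\<open>B\<close> a unit matrix).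
\<close>

lemma line_expansion:
  assumes "poly_fun f"
  shows "\<exists>P d. (\<forall>A B t. f (A + cscale t B) = poly (P A B) t) \<and> (\<forall>A B. degree (P A B) \<le> d) \<and>
    (\<forall>k B. poly_fun (\<lambda>A. coeff (P A B) k)) \<and> (\<forall>k A. poly_fun (\<lambda>B. coeff (P A B) k))"
  using assms
proof induction
  case (const c)
  show ?case
    by (rule exI[of _ "\<lambda>A B. [:c:]"], rule exI[of _ 0]) (auto intro: poly_fun.const)
next
  case (entry i j)
  have "poly_fun (\<lambda>A. coeff [:A $ i $ j, c:] k)" "poly_fun (\<lambda>A. coeff [:c, A $ i $ j:] k)"
    for c and k :: nat
    by (cases k; cases "k - 1"; auto simp: coeff_pCons intro: poly_fun.intros split: nat.splits)+
  then show ?case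
    by (intro exI[of _ "\<lambda>A B. [:A $ i $ j, B $ i $ j:]"] exI[of _ 1])
      (auto simp: cscale_def)
next
  case (add f g)
  then obtain P d Q e where *: "\<forall>A B t. f (A + cscale t B) = poly (P A B) t"
    "\<forall>A B. degree (P A B) \<le> d" "\<forall>k B. poly_fun (\<lambda>A. coeff (P A B) k)"
    "\<forall>k A. poly_fun (\<lambda>B. coeff (P A B) k)" "\<forall>A B t. g (A + cscale t B) = poly (Q A B) t"
    "\<forall>A B. degree (Q A B) \<le> e" "\<forall>k B. poly_fun (\<lambda>A. coeff (Q A B) k)"
    "\<forall>k A. poly_fun (\<lambda>B. coeff (Q A B) k)" by metis
  have "degree (P A B + Q A B) \<le> max d e" for A B
    using * by (meson degree_add_le_max max.mono order_trans)
  then show ?case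
    using * by (intro exI[of _ "\<lambda>A B. P A B + Q A B"] exI[of _ "max d e"]) (auto intro: poly_fun.add)
next
  case (mult f g)
  then obtain P d Q e where *: "\<forall>A B t. f (A + cscale t B) = poly (P A B) t"
    "\<forall>A B. degree (P A B) \<le> d" "\<forall>k B. poly_fun (\<lambda>A. coeff (P A B) k)"
    "\<forall>k A. poly_fun (\<lambda>B. coeff (P A B) k)" "\<forall>A B t. g (A + cscale t B) = poly (Q A B) t"
    "\<forall>A B. degree (Q A B) \<le> e" "\<forall>k B. poly_fun (\<lambda>A. coeff (Q A B) k)"
    "\<forall>k A. poly_fun (\<lambda>B. coeff (Q A B) k)" by metis
  have "degree (P A B * Q A B) \<le> d + e" for A B
    using * by (meson degree_mult_le add_mono order_trans)
  then show ?case
    using * by (intro exI[of _ "\<lambda>A B. P A B * Q A B"] exI[of _ "d + e"])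
      (auto simp: coeff_mult intro!: poly_fun_intros)
qed

lemma poly_fun_restrict_line:
  assumes "poly_fun f"
  obtains p where "\<And>t. f (A + cscale t B) = poly p t"
  using line_expansion[OF assms] by metis

text \<open>
  Affine space is irreducible: restricted to the line through the two points where \<open>f\<close> and \<open>g\<close> do
  not vanish, both are nonzero polynomials in one variable.
\<close>

lemma poly_fun_nonzero_mult:
  assumes "poly_fun f" "poly_fun g" "f A \<noteq> 0" "g B \<noteq> 0"
  shows "\<exists>C. f C * g C \<noteq> 0"
proof -
  obtain p where p: "\<And>t. f (A + cscale t (B - A)) = poly p t"
    using poly_fun_restrict_line[OF assms(1), of A "B - A"] by blast
  obtain q where q: "\<And>t. g (A + cscale t (B - A)) = poly q t"
    using poly_fun_restrict_line[OF assms(2), of A "B - A"] by blast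
  have "poly p 0 \<noteq> 0" "poly q 1 \<noteq> 0"
    using p[of 0] q[of 1] assms by auto
  then have "p * q \<noteq> 0"
    by auto
  then obtain t where "poly (p * q) t \<noteq> 0"
    using poly_all_0_iff_0 by blast
  then show ?thesis
    using p q by (intro exI[of _ "A + cscale t (B - A)"]) simp
qed

text \<open>
  The component \<open>f'\<close> is a coefficient of \<open>t \<mapsto> f (t B)\<close>. This is what identifies the Zariski topology of
  projective space with that of cones: a cone that is cut out by polynomials is cut out by homogeneous
  ones.
\<close>

lemma homogeneous_components:
  assumes "poly_fun f" "f A \<noteq> 0"
  shows "\<exists>f'. hom_poly f' \<and> f' A \<noteq> 0 \<and> (\<forall>B. (\<forall>c. c \<noteq> 0 \<longrightarrow> f (cscale c B) = 0) \<longrightarrow> f' B = 0)"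
proof -
  obtain Q d where "\<forall>A B t. f (A + cscale t B) = poly (Q A B) t"
      and Q: "\<forall>k A. poly_fun (\<lambda>B. coeff (Q A B) k)"
    using line_expansion[OF assms(1)] by blast
  then have ev: "f (cscale t B) = poly (Q 0 B) t" for t B
    by (metis add.left_neutral)
  have "poly (Q 0 A) 1 \<noteq> 0"
    using ev[of 1 A] assms(2) by simp
  then have "Q 0 A \<noteq> 0"
    by auto
  then obtain k where k: "coeff (Q 0 A) k \<noteq> 0"
    using leading_coeff_neq_0 by blast
  have "Q 0 (cscale c B) = pcompose (Q 0 B) [:0, c:]" for c B
  proof -
    have "poly (Q 0 (cscale c B)) t = poly (pcompose (Q 0 B) [:0, c:]) t" for t
      using ev[of t "cscale c B"] ev[of "t * c" B] by (simp add: cscale_eq_mult poly_pcompose)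
    then show ?thesis
      using poly_eq_poly_eq_iff by blast
  qed
  then have "hom_poly (\<lambda>B. coeff (Q 0 B) k)"
    unfolding hom_poly_def using Q by (auto simp: coeff_pcompose_linear)
  moreover have "coeff (Q 0 B) k = 0" if "\<forall>c. c \<noteq> 0 \<longrightarrow> f (cscale c B) = 0" for B
  proof -
    have "UNIV - {0} \<subseteq> {t. poly (Q 0 B) t = 0}"
      using that ev by auto
    moreover have "infinite (UNIV - {0::complex})"
      by (simp add: infinite_UNIV_char_0)
    ultimately have "Q 0 B = 0"
      using poly_roots_finite finite_subset by blast
    then show ?thesis by simp
  qed
  ultimately show ?thesis
    using k by blast
qed

text \<open>
  All properties of the derivative go into one induction because the product rule needs them at once:
  existence, complex homogeneity in the direction and polynomial dependence on the base point.
\<close>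

lemma poly_fun_derivative:
  fixes f :: "complex^'m^'k \<Rightarrow> complex"
  assumes "poly_fun f"
  shows "\<exists>D. (\<forall>A. (f has_derivative D A) (at A)) \<and> (\<forall>A c v. D A (cscale c v) = c * D A v) \<and>
    (\<forall>v. poly_fun (\<lambda>A. D A v))"
  using assms
proof induction
  case (const c)
  show ?case
    by (rule exI[of _ "\<lambda>A v. 0"]) (auto intro: poly_fun.const)
next
  case (entry i j)
  have "bounded_linear (\<lambda>A::complex^'m^'k. A $ i $ j)"
    using bounded_linear_compose[OF bounded_linear_vec_nth[of j] bounded_linear_vec_nth[of i]]
    by simp
  then show ?case
    by (intro exI[of _ "\<lambda>A v. v $ i $ j"])
      (auto simp: cscale_def bounded_linear_imp_has_derivative intro: poly_fun.const)
next
  case (add f g)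
  then obtain D E where "\<forall>A. (f has_derivative D A) (at A)" "\<forall>A c v. D A (cscale c v) = c * D A v"
     "\<forall>v. poly_fun (\<lambda>A. D A v)" "\<forall>A. (g has_derivative E A) (at A)"
     "\<forall>A c v. E A (cscale c v) = c * E A v" "\<forall>v. poly_fun (\<lambda>A. E A v)" by metis
  then show ?case
    by (intro exI[of _ "\<lambda>A v. D A v + E A v"])
      (auto simp: algebra_simps intro!: poly_fun_intros has_derivative_add)
next
  case (mult f g)
  then obtain D E where "\<forall>A. (f has_derivative D A) (at A)" "\<forall>A c v. D A (cscale c v) = c * D A v"
     "\<forall>v. poly_fun (\<lambda>A. D A v)" "\<forall>A. (g has_derivative E A) (at A)"
     "\<forall>A c v. E A (cscale c v) = c * E A v" "\<forall>v. poly_fun (\<lambda>A. E A v)" by metis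
  then show ?case
    by (intro exI[of _ "\<lambda>A v. f A * E A v + D A v * g A"])
      (use mult.hyps in \<open>auto simp: ring_distribs mult.left_commute mult.assoc
         intro!: poly_fun_intros has_derivative_mult\<close>)
qed

lemma has_derivative_differential: "poly_fun f \<Longrightarrow> (f has_derivative differential f A) (at A)"
  using poly_fun_derivative frechet_derivative_at unfolding differential_def by metis

lemma linear_differential: "poly_fun f \<Longrightarrow> linear (differential f A)"
  using has_derivative_differential has_derivative_linear by blast

lemma differential_cscale: "poly_fun f \<Longrightarrow> differential f A (cscale c v) = c * differential f A v"
  using poly_fun_derivative frechet_derivative_at unfolding differential_def by metis

lemma poly_fun_differential: "poly_fun f \<Longrightarrow> poly_fun (\<lambda>A. differential f A v)"
  using poly_fun_derivative frechet_derivative_at unfolding differential_def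
  by (metis (no_types, lifting) ext)

lemma differential_eqI: "(f has_derivative D) (at A) \<Longrightarrow> differential f A = D"
  unfolding differential_def using frechet_derivative_at by metis

lemma differential_add:
  "poly_fun f \<Longrightarrow> poly_fun g \<Longrightarrow> differential (\<lambda>A. f A + g A) A v = differential f A v + differential g A v"
  by (subst differential_eqI) (auto intro: has_derivative_add has_derivative_differential)

lemma differential_mult:
  "poly_fun f \<Longrightarrow> poly_fun g \<Longrightarrow>
    differential (\<lambda>A. f A * g A) A v = f A * differential g A v + differential f A v * g A"
  by (subst differential_eqI[OF has_derivative_mult]) (auto intro: has_derivative_differential)

lemma differential_const: "differential (\<lambda>A. c) A v = 0"
  by (subst differential_eqI[OF has_derivative_const]) auto

lemma scaleR_eq_cscale: "t *\<^sub>R A = cscale (of_real t) A"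
  by (simp add: cscale_def vec_eq_iff scaleR_conv_of_real[symmetric])

lemma differential_line:
  assumes "poly_fun f"
  shows "((\<lambda>t::real. f (A + t *\<^sub>R v)) has_vector_derivative differential f A v) (at 0)"
proof -
  have "((\<lambda>t::real. A + t *\<^sub>R v) has_derivative (\<lambda>t. t *\<^sub>R v)) (at 0)"
    by (auto intro!: derivative_eq_intros)
  moreover have "(f has_derivative differential f A) (at (A + 0 *\<^sub>R v))"
    using has_derivative_differential[OF assms, of A] by simp
  ultimately have "((\<lambda>t::real. f (A + t *\<^sub>R v)) has_derivative (\<lambda>t. differential f A (t *\<^sub>R v))) (at 0)"
    by (rule has_derivative_compose)
  then show ?thesis
    using linear_differential[OF assms] by (simp add: has_vector_derivative_def linear_cmul)
qed

text \<open>
  The differential in the direction \<open>v\<close> sees only the germ of \<open>f\<close> on a real line. All chain rules that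
  occur later are instances of this: two polynomials on different spaces whose restrictions to two
  lines agree near the base points have the same derivative along them.
\<close>

lemma differential_cong_line:
  assumes "poly_fun f" "poly_fun g"
    and "\<forall>\<^sub>F t in nhds (0::real). f (A + t *\<^sub>R v) = g (B + t *\<^sub>R w)"
  shows "differential f A v = differential g B w"
proof -
  have "((\<lambda>t. f (A + t *\<^sub>R v)) has_derivative (\<lambda>t. t *\<^sub>R differential f A v)) (at 0)"
    using differential_line[OF assms(1), of A v] by (simp add: has_vector_derivative_def)
  moreover have "\<forall>\<^sub>F t in at 0. f (A + t *\<^sub>R v) = g (B + t *\<^sub>R w)"
    using assms(3) by (simp add: eventually_nhds_conv_at)
  moreover have "f (A + 0 *\<^sub>R v) = g (B + 0 *\<^sub>R w)"
    using eventually_nhds_x_imp_x[OF assms(3)] .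
  ultimately have "((\<lambda>t. g (B + t *\<^sub>R w)) has_vector_derivative differential f A v) (at 0)"
    unfolding has_vector_derivative_def by (rule has_derivative_transform_eventually) simp
  then show ?thesis
    using differential_line[OF assms(2)] vector_derivative_unique_at by blast
qed

section \<open>Generic smoothness by triangular equations\<close>

definition depends_on :: "('k \<times> 'm) set \<Rightarrow> (complex^'m^'k \<Rightarrow> complex) \<Rightarrow> bool" where
  "depends_on J f \<longleftrightarrow> (\<forall>A B. (\<forall>(i, j)\<in>J. A $ i $ j = B $ i $ j) \<longrightarrow> f A = f B)"

definition unit_matrix :: "'k \<Rightarrow> 'm \<Rightarrow> complex^'m^'k" where
  "unit_matrix i j = (\<chi> k l. if k = i \<and> l = j then 1 else 0)"

lemma depends_on_mono: "depends_on J f \<Longrightarrow> J \<subseteq> K \<Longrightarrow> depends_on K f"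
  unfolding depends_on_def by blast

lemma depends_on_const: "depends_on J (\<lambda>A. c)"
  by (simp add: depends_on_def)

lemma depends_on_mult: "depends_on J f \<Longrightarrow> depends_on J g \<Longrightarrow> depends_on J (\<lambda>A. f A * g A)"
  unfolding depends_on_def by (intro allI impI arg_cong2[of _ _ _ _ "(*)"]) blast+

lemma depends_on_diff: "depends_on J f \<Longrightarrow> depends_on J g \<Longrightarrow> depends_on J (\<lambda>A. f A - g A)"
  unfolding depends_on_def by (intro allI impI arg_cong2[of _ _ _ _ "(-)"]) blast+

lemmas depends_on_intros = depends_on_const depends_on_mult depends_on_diff

text \<open>
  The bound is strict, so that \<open>D = 0\<close> represents the zero polynomial; inductions on \<open>D\<close> can then start
  there.
\<close>

lemma expansion_in_coordinate:
  fixes f :: "complex^'m^'k \<Rightarrow> complex"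
  assumes "poly_fun f" "depends_on (insert (i, j) J) f"
  shows "\<exists>D b. (\<forall>e. poly_fun (b e) \<and> depends_on J (b e)) \<and> f = (\<lambda>A. \<Sum>e<D. b e A * (A $ i $ j) ^ e)"
proof -
  \<comment> \<open>\<open>Z\<close> replaces the entry at \<open>(i, j)\<close> by zero, so that \<open>A\<close> lies on the line through \<open>Z A\<close> in the direction \<open>E\<close>.\<close>
  define E :: "complex^'m^'k" where "E = unit_matrix i j"
  define Z where "Z A = A - cscale (A $ i $ j) E" for A :: "complex^'m^'k"
  have Z: "Z A $ k $ l = (if (k, l) = (i, j) then 0 else A $ k $ l)" for A k l
    by (auto simp: Z_def E_def cscale_def unit_matrix_def)
  obtain P d where P: "\<And>A B t. f (A + cscale t B) = poly (P A B) t" "\<And>A B. degree (P A B) \<le> d"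
      "\<And>k B. poly_fun (\<lambda>A. coeff (P A B) k)"
    using line_expansion[OF assms(1)] by metis
  define b where "b e A = coeff (P (Z A) E) e" for e A
  have polyZ: "poly_map Z"
    unfolding poly_map_def Z by (auto intro!: poly_fun_if poly_fun.intros)
  have "f A = (\<Sum>e<Suc d. b e A * (A $ i $ j) ^ e)" for A
  proof -
    have "f A = poly (P (Z A) E) (A $ i $ j)"
      by (metis P(1) Z_def diff_add_cancel)
    also have "\<dots> = (\<Sum>e<Suc d. b e A * (A $ i $ j) ^ e)"
      unfolding poly_altdef b_def
      by (rule sum.mono_neutral_left) (use P(2)[of "Z A" E] in \<open>auto simp: coeff_eq_0 not_le\<close>)
    finally show ?thesis .
  qed
  moreover have "poly_fun (b e)" for e
    unfolding b_def using poly_fun_compose[OF P(3) polyZ] by simp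
  moreover have "depends_on J (b e)" for e
    unfolding depends_on_def
  proof (intro allI impI)
    fix A B :: "complex^'m^'k" assume *: "\<forall>(i, j)\<in>J. A $ i $ j = B $ i $ j"
    have "f (Z A + cscale t E) = f (Z B + cscale t E)" for t
    proof (rule assms(2)[unfolded depends_on_def, rule_format])
      show "case x of (k, l) \<Rightarrow> (Z A + cscale t E) $ k $ l = (Z B + cscale t E) $ k $ l"
        if "x \<in> insert (i, j) J" for x
        using that * Z by (cases x) (auto split: prod.splits)
    qed
    then have "P (Z A) E = P (Z B) E"
      by (simp add: P(1) poly_eq_poly_eq_iff[symmetric] fun_eq_iff)
    then show "b e A = b e B"
      by (simp add: b_def)
  qed
  ultimately show ?thesis
    by (intro exI[of _ "Suc d"] exI[of _ b]) auto
qed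

lemma differential_in_coordinate:
  fixes b :: "nat \<Rightarrow> complex^'m^'k \<Rightarrow> complex"
  assumes "\<And>e. poly_fun (b e)" "\<And>e. depends_on J (b e)" "(i, j) \<notin> J"
  shows "differential (\<lambda>A. \<Sum>e<Suc d. b e A * (A $ i $ j) ^ e) A (unit_matrix i j) =
    (\<Sum>e<d. of_nat (Suc e) * b (Suc e) A * (A $ i $ j) ^ e)"
proof -
  let ?f = "\<lambda>A. \<Sum>e<Suc d. b e A * (A $ i $ j) ^ e"
  have b: "b e (A + t *\<^sub>R unit_matrix i j) = b e A" for e t
    by (rule assms(2)[unfolded depends_on_def, rule_format])
      (use assms(3) in \<open>auto simp: unit_matrix_def split: prod.splits\<close>)
  have X: "(A + t *\<^sub>R unit_matrix i j) $ i $ j = A $ i $ j + of_real t" for t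
    by (simp add: scaleR_eq_cscale cscale_def unit_matrix_def)
  have "poly_fun ?f"
    using assms by (intro poly_fun_intros)
  from differential_line[OF this, of A "unit_matrix i j"]
  have "((\<lambda>t::real. \<Sum>e<Suc d. b e A * (A $ i $ j + of_real t) ^ e) has_vector_derivative
      differential ?f A (unit_matrix i j)) (at 0)"
    unfolding b X .
  moreover have "((\<lambda>t::real. \<Sum>e<Suc d. b e A * (A $ i $ j + of_real t) ^ e) has_vector_derivative
      (\<Sum>e<Suc d. of_nat e * b e A * (A $ i $ j) ^ (e - 1))) (at 0)"
  proof (rule has_vector_derivative_sum)
    fix e
    have "((\<lambda>z. b e A * (A $ i $ j + z) ^ e) has_field_derivative of_nat e * b e A * (A $ i $ j) ^ (e - 1))
       (at (of_real 0))"
      by (auto intro!: derivative_eq_intros)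
    then show "((\<lambda>t::real. b e A * (A $ i $ j + of_real t) ^ e) has_vector_derivative
      of_nat e * b e A * (A $ i $ j) ^ (e - 1)) (at 0)"
      by (rule has_vector_derivative_real_field)
  qed
  ultimately have "differential ?f A (unit_matrix i j) = (\<Sum>e<Suc d. of_nat e * b e A * (A $ i $ j) ^ (e - 1))"
    using vector_derivative_unique_at by blast
  also have "\<dots> = (\<Sum>e<d. of_nat (Suc e) * b (Suc e) A * (A $ i $ j) ^ e)"
    by (simp only: sum.lessThan_Suc_shift) simp
  finally show ?thesis .
qed

lemma differential_depends_on:
  assumes "poly_fun f" "depends_on J f" "(i, j) \<notin> J"
  shows "differential f A (unit_matrix i j) = 0"
proof -
  have "f (A + t *\<^sub>R unit_matrix i j) = f A" for t
    by (rule assms(2)[unfolded depends_on_def, rule_format])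
      (use assms(3) in \<open>auto simp: unit_matrix_def split: prod.splits\<close>)
  then have "differential f A (unit_matrix i j) = differential (\<lambda>B. f A) A 0"
    by (intro differential_cong_line) (auto intro: assms(1) poly_fun.const)
  then show ?thesis
    by (simp add: differential_const)
qed

text \<open>
  Equivalently, the ideal of polynomials vanishing on \<open>P\<close> is prime, or the Zariski closure of \<open>P\<close> is
  irreducible.
\<close>

definition prime_locus :: "(complex^'m^'k) set \<Rightarrow> bool" where
  "prime_locus P \<longleftrightarrow> P \<noteq> {} \<and> (\<forall>f g. poly_fun f \<longrightarrow> poly_fun g \<longrightarrow>
     (\<exists>A\<in>P. f A \<noteq> 0) \<longrightarrow> (\<exists>A\<in>P. g A \<noteq> 0) \<longrightarrow> (\<exists>A\<in>P. f A * g A \<noteq> 0))"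

text \<open>
  Only polynomials in the coordinates \<open>J\<close> are tested against \<open>F\<close>, which makes an induction over the
  coordinates possible. For \<open>J = UNIV\<close> the condition says that \<open>F\<close> cuts out the closure of \<open>P\<close> on the
  open set \<open>u \<noteq> 0\<close>.
\<close>

definition generic_equations ::
    "('k \<times> 'm) set \<Rightarrow> (complex^'m^'k) set \<Rightarrow> (complex^'m^'k \<Rightarrow> complex) set \<Rightarrow> (complex^'m^'k \<Rightarrow> complex) \<Rightarrow> bool"
  where "generic_equations J P F u \<longleftrightarrow>
    finite F \<and> (\<forall>f\<in>F. poly_fun f \<and> depends_on J f \<and> (\<forall>A\<in>P. f A = 0)) \<and>
    poly_fun u \<and> depends_on J u \<and> (\<exists>A\<in>P. u A \<noteq> 0) \<and>
    (\<forall>A. u A \<noteq> 0 \<longrightarrow> (\<forall>f\<in>F. f A = 0) \<longrightarrow>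
       (\<forall>q. poly_fun q \<and> depends_on J q \<and> (\<forall>B\<in>P. q B = 0) \<longrightarrow> q A = 0)) \<and>
    (\<forall>A. u A \<noteq> 0 \<longrightarrow>
       (\<forall>c. (\<forall>v. (\<Sum>f\<in>F. c f * differential f A v) = 0) \<longrightarrow> (\<forall>f\<in>F. c f = 0)))"

text \<open>
  The equations are built one coordinate \<open>x\<close> at a time. Let \<open>F\<close>, \<open>u\<close> be the equations already found in
  the coordinates \<open>J\<close>. If every member of the ideal that involves \<open>J\<close> and \<open>x\<close> has all its coefficients
  (as a polynomial in \<open>x\<close>) in the ideal, then \<open>F\<close> and \<open>u\<close> still serve. Otherwise one equation \<open>p\<close> is
  added, of least degree \<open>d\<close> in \<open>x\<close> among the members whose leading coefficient is not in the ideal.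
  Where \<open>F\<close> and \<open>p\<close> vanish but the leading coefficient of \<open>p\<close> does not, pseudo-division by \<open>p\<close>
  reduces each member of the ideal to one of degree less than \<open>d\<close>, which vanishes by minimality.
  The derivative \<open>p'\<close> with respect to \<open>x\<close> is not in the ideal, again by minimality of \<open>d\<close> and since the
  characteristic is zero. Where it does not vanish the differential of \<open>p\<close> is independent of those of
  \<open>F\<close>, as the latter are zero in the direction of \<open>x\<close>.
\<close>

lemma triangular_equations:
  fixes P :: "(complex^'m^'k) set" and J :: "('k \<times> 'm) set"
  assumes prime: "prime_locus P" and "finite J"
  shows "\<exists>F u. generic_equations J P F u"
  using assms(2)
proof (induction J)
  case empty
  have "q A = 0" if "depends_on {} q" "\<forall>B\<in>P. q B = 0" for q and A :: "complex^'m^'k"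
    using that prime unfolding depends_on_def prime_locus_def by (metis empty_iff equals0I)
  moreover have "\<exists>A. A \<in> P"
    using prime by (auto simp: prime_locus_def)
  ultimately show ?case
    by (intro exI[of _ "{}"] exI[of _ "\<lambda>A. 1"])
      (auto simp: generic_equations_def depends_on_def intro: poly_fun.const)
next
  case (insert x J)
  obtain i j where x: "x = (i, j)" by (cases x)
  obtain F u where Fu: "generic_equations J P F u"
    using insert.IH by blast
  have F: "finite F" "\<And>f. f \<in> F \<Longrightarrow> poly_fun f" "\<And>f. f \<in> F \<Longrightarrow> depends_on J f"
      "\<And>f A. f \<in> F \<Longrightarrow> A \<in> P \<Longrightarrow> f A = 0"
    and u: "poly_fun u" "depends_on J u" "\<exists>A\<in>P. u A \<noteq> 0"
    and gen: "\<And>q A. \<lbrakk>poly_fun q; depends_on J q; \<forall>B\<in>P. q B = 0; u A \<noteq> 0; \<forall>f\<in>F. f A = 0\<rbrakk> \<Longrightarrow> q A = 0"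
    and indep: "\<And>A c f. \<lbrakk>u A \<noteq> 0; \<forall>v. (\<Sum>f\<in>F. c f * differential f A v) = 0; f \<in> F\<rbrakk> \<Longrightarrow> c f = 0"
    using Fu unfolding generic_equations_def by blast+
  define X where "X A = A $ i $ j" for A :: "complex^'m^'k"
  have X: "poly_fun X" "depends_on (insert x J) X"
    unfolding X_def depends_on_def x by (auto intro: poly_fun.entry)
  define coefs where "coefs b \<longleftrightarrow> (\<forall>e. poly_fun (b e) \<and> depends_on J (b e))"
    for b :: "nat \<Rightarrow> complex^'m^'k \<Rightarrow> complex"
  define ex where "ex D b A = (\<Sum>e<D. b e A * X A ^ e)"
    for D :: nat and b :: "nat \<Rightarrow> complex^'m^'k \<Rightarrow> complex" and A
  have ex_poly: "poly_fun (ex D b)" if "coefs b" for D b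
    unfolding ex_def using that X by (intro poly_fun_intros) (auto simp: coefs_def)
  have ex_dep: "depends_on (insert x J) (ex D b)" if "coefs b" for D b
    unfolding depends_on_def
  proof (intro allI impI)
    fix A B :: "complex^'m^'k" assume *: "\<forall>(i, j)\<in>insert x J. A $ i $ j = B $ i $ j"
    then have "X A = X B" "b e A = b e B" for e
      using that by (auto simp: x X_def coefs_def depends_on_def)
    then show "ex D b A = ex D b B"
      by (simp add: ex_def)
  qed
  have expand: "\<exists>D b. coefs b \<and> q = ex D b" if "poly_fun q" "depends_on (insert x J) q" for q
    using expansion_in_coordinate[OF that(1), of i j J] that(2) unfolding coefs_def ex_def X_def x by blast
  \<comment> \<open>For \<open>good d\<close> the ideal has a member with a coefficient outside the ideal in degree \<open>d\<close> and none above.\<close>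
  define good where "good d \<longleftrightarrow> (\<exists>b. coefs b \<and> (\<forall>A\<in>P. ex (Suc d) b A = 0) \<and> (\<exists>A\<in>P. b d A \<noteq> 0))" for d
  \<comment> \<open>Below the least good degree leading coefficients lie in the ideal and can be split off one by one.\<close>
  have strip: "ex N b A = 0"
    if "\<And>d. d < N \<Longrightarrow> \<not> good d" "coefs b" "\<forall>A\<in>P. ex N b A = 0" "u A \<noteq> 0" "\<forall>f\<in>F. f A = 0" for N b A
    using that
  proof (induction N)
    case 0
    show ?case by (simp add: ex_def)
  next
    case (Suc N)
    have top: "\<forall>B\<in>P. b N B = 0"
      using Suc.prems(1)[of N] Suc.prems(2,3) by (auto simp: good_def)
    then have "b N A = 0"
      using gen[of "b N" A] Suc.prems by (auto simp: coefs_def)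
    moreover have "ex N b A = 0"
      using Suc.IH Suc.prems top by (simp add: ex_def)
    ultimately show ?case
      by (simp add: ex_def)
  qed
  show ?case
  proof (cases "\<exists>d. good d")
    case False
    have "q A = 0" if q: "poly_fun q" "depends_on (insert x J) q" "\<forall>B\<in>P. q B = 0" "u A \<noteq> 0" "\<forall>f\<in>F. f A = 0" for q A
      using expand[OF q(1,2)] strip q(3-) False by metis
    then show ?thesis
      using F u indep depends_on_mono[of J _ "insert x J"]
      by (intro exI[of _ F] exI[of _ u]) (unfold generic_equations_def, blast)
  next
    case True
    define d where "d = (LEAST d. good d)"
    have "good d" and min: "\<And>e. e < d \<Longrightarrow> \<not> good e"
      unfolding d_def using True LeastI not_less_Least by metis+
    then obtain b where b: "coefs b" "\<forall>A\<in>P. ex (Suc d) b A = 0" "\<exists>A\<in>P. b d A \<noteq> 0"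
      by (auto simp: good_def)
    let ?p = "ex (Suc d) b"
    have "d \<noteq> 0"
    proof
      assume "d = 0"
      then show False
        using b by (simp add: ex_def)
    qed
    define b' where "b' e A = of_nat (Suc e) * b (Suc e) A" for e A
    let ?p' = "ex d b'"
    have b': "coefs b'"
      using b(1) unfolding coefs_def b'_def by (intro allI conjI poly_fun_intros depends_on_intros) auto
    have diff_p: "differential ?p A (unit_matrix i j) = ?p' A" for A
      using differential_in_coordinate[of b J i j d A] b(1) insert.hyps(2)
      unfolding ex_def coefs_def X_def b'_def x by simp
    have p'_nz: "\<exists>A\<in>P. ?p' A \<noteq> 0"
    proof (rule ccontr)
      assume "\<not> ?thesis"
      then have "good (d - 1)"
        unfolding good_def using b(3) b' \<open>d \<noteq> 0\<close>
        by (intro exI[of _ b']) (auto simp: b'_def simp del: of_nat_Suc)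
      then show False
        using min \<open>d \<noteq> 0\<close> by simp
    qed
    \<comment> \<open>The new open set: the leading coefficient allows pseudo-division, the derivative gives independence.\<close>
    define w where "w A = u A * b d A * ?p' A" for A
    have b_d: "poly_fun (b d)" "depends_on J (b d)"
      using b(1) by (auto simp: coefs_def)
    have "\<exists>A\<in>P. w A \<noteq> 0"
    proof -
      have "\<exists>A\<in>P. u A * b d A \<noteq> 0"
        using prime u(1,3) b(3) b_d unfolding prime_locus_def by blast
      then show ?thesis
        using prime p'_nz poly_fun.mult[OF u(1) b_d(1)] ex_poly[OF b'] unfolding prime_locus_def w_def by blast
    qed
    have reduce: "ex D c A = 0"
      if "coefs c" "\<forall>A\<in>P. ex D c A = 0" "w A \<noteq> 0" "\<forall>f\<in>F. f A = 0" "?p A = 0" for D c A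
      using that(1,2)
    proof (induction D arbitrary: c)
      case 0
      show ?case by (simp add: ex_def)
    next
      case (Suc D)
      show ?case
      proof (cases "D < d")
        case True
        then show ?thesis
          using strip[of "Suc D" c A] min Suc.prems that by (auto simp: w_def)
      next
        case False
        \<comment> \<open>One step of pseudo-division by \<open>p\<close>: the coefficients of \<open>lc(p) c - c\<^sub>D x\<^sup>D\<^sup>-\<^sup>d p\<close>, of degree below \<open>D\<close>.\<close>
        define r where "r e A = b d A * c e A - (if e < D - d then 0 else c D A * b (e - (D - d)) A)" for e A
        have r: "coefs r"
          unfolding coefs_def
        proof (intro allI conjI)
          fix e
          have "poly_fun (b e)" "depends_on J (b e)" "poly_fun (c e)" "depends_on J (c e)" for e
            using Suc.prems(1) b(1) by (auto simp: coefs_def)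
          then show "poly_fun (r e)" "depends_on J (r e)"
            unfolding r_def by (cases "e < D - d"; auto intro!: poly_fun_intros depends_on_intros)+
        qed
        have sub: "ex D r B = b d B * ex (Suc D) c B - c D B * X B ^ (D - d) * ?p B" for B
        proof -
          have "(\<Sum>e<Suc D. (if e < D - d then 0 else c D B * b (e - (D - d)) B) * X B ^ e)
            = (\<Sum>e=D-d..<Suc D. c D B * b (e - (D - d)) B * X B ^ e)"
            by (rule sum.mono_neutral_cong_right) auto
          also have "\<dots> = (\<Sum>e=0..<Suc d. c D B * b e B * X B ^ (e + (D - d)))"
            using False sum.shift_bounds_nat_ivl[of "\<lambda>e. c D B * b (e - (D - d)) B * X B ^ e" 0 "D - d" "Suc d"]
            by simp
          also have "\<dots> = c D B * X B ^ (D - d) * ?p B"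
            by (simp only: ex_def sum_distrib_left power_add mult_ac atLeast0LessThan)
          finally have "(\<Sum>e<Suc D. r e B * X B ^ e) = b d B * ex (Suc D) c B - c D B * X B ^ (D - d) * ?p B"
            by (simp only: r_def left_diff_distrib sum_subtractf ex_def sum_distrib_left mult.assoc)
          moreover have "r D B = 0"
            using False by (simp add: r_def)
          ultimately show ?thesis
            by (simp add: ex_def)
        qed
        have "ex D r A = 0"
          using Suc.IH[OF r] sub Suc.prems(2) b(2) by simp
        then have "b d A * ex (Suc D) c A = 0"
          using sub that(5) by simp
        then show ?thesis
          using that(3) by (simp add: w_def)
      qed
    qed
    have diff_F: "differential f A (unit_matrix i j) = 0" if "f \<in> F" for f A
      using differential_depends_on F(2,3) that insert.hyps(2) by (metis x)
    then have p_notin: "?p \<notin> F"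
      using p'_nz diff_p by metis
    have "c f = 0" if "w A \<noteq> 0" and *: "\<forall>v. (\<Sum>f\<in>insert ?p F. c f * differential f A v) = 0" and "f \<in> insert ?p F"
      for A c f
    proof -
      have split: "c ?p * differential ?p A v + (\<Sum>f\<in>F. c f * differential f A v) = 0" for v
        using *[rule_format, of v] F(1) p_notin by simp
      have "c ?p = 0"
        using split[of "unit_matrix i j"] diff_F diff_p \<open>w A \<noteq> 0\<close> by (simp add: w_def)
      then show ?thesis
        using split indep[of A c] that by (auto simp: w_def)
    qed
    moreover have "depends_on (insert x J) w"
      unfolding w_def
      using depends_on_mono[OF u(2), of "insert x J"] depends_on_mono[OF b_d(2), of "insert x J"] ex_dep[OF b', of d]
      by (auto intro!: depends_on_intros)
    moreover have "poly_fun w"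
      unfolding w_def using u(1) b_d(1) ex_poly[OF b'] by (intro poly_fun.mult)
    moreover have "q A = 0" if q: "poly_fun q" "depends_on (insert x J) q" "\<forall>B\<in>P. q B = 0" "w A \<noteq> 0"
      "\<forall>f\<in>insert ?p F. f A = 0" for q A
      using expand[OF q(1,2)] reduce q(3-) by (metis insertCI)
    moreover have "poly_fun f \<and> depends_on (insert x J) f \<and> (\<forall>A\<in>P. f A = 0)" if "f \<in> insert ?p F" for f
      using that F(2,4) depends_on_mono[OF F(3), of f "insert x J"] ex_poly[OF b(1)] ex_dep[OF b(1)] b(2) by blast
    ultimately show ?thesis
      using F(1) \<open>\<exists>A\<in>P. w A \<noteq> 0\<close> by (intro exI[of _ "insert ?p F"] exI[of _ w]) (unfold generic_equations_def, blast)
  qed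
qed

text \<open>
  The closure of \<open>P\<close> in \<open>zariski\<close>, described by the ideal of \<open>P\<close>.
\<close>

definition zariski_hull :: "(complex^'m^'k) set \<Rightarrow> (complex^'m^'k) set" where
  "zariski_hull P = {A. \<forall>f. poly_fun f \<and> (\<forall>B\<in>P. f B = 0) \<longrightarrow> f A = 0}"

lemma openin_zariski_nonvanishing: "poly_fun u \<Longrightarrow> openin zariski {A. u A \<noteq> 0}"
  unfolding openin_zariski by (rule exI[of _ "{u}"]) auto

lemma zariski_hull_superset: "P \<subseteq> zariski_hull P"
  by (auto simp: zariski_hull_def)

text \<open>
  In all coordinates, the triangular equations present the closure of \<open>P\<close> as required of a smooth
  point, on the open set where \<open>u\<close> does not vanish. That set meets \<open>P\<close>.
\<close>

lemma generic_smoothness: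
  fixes P :: "(complex^'m^'k) set"
  assumes "prime_locus P"
  obtains u where "poly_fun u" "\<exists>A\<in>P. u A \<noteq> 0"
    "\<And>A. A \<in> zariski_hull P \<Longrightarrow> u A \<noteq> 0 \<Longrightarrow> smooth_point (zariski_hull P) A"
proof -
  have dep: "depends_on UNIV f" for f :: "complex^'m^'k \<Rightarrow> complex"
    unfolding depends_on_def vec_eq_iff[symmetric] by (auto simp: vec_eq_iff[symmetric])
  obtain F u where Fu: "generic_equations UNIV P F u"
    using triangular_equations[OF assms finite[of UNIV]] by blast
  have F: "finite F" "\<And>f. f \<in> F \<Longrightarrow> poly_fun f" 
      "\<And>f A. f \<in> F \<Longrightarrow> A \<in> P \<Longrightarrow> f A = 0"
    and u: "poly_fun u"  "\<exists>A\<in>P. u A \<noteq> 0"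
    and gen: "\<And>q A. \<lbrakk>poly_fun q; depends_on UNIV q; \<forall>B\<in>P. q B = 0; u A \<noteq> 0; \<forall>f\<in>F. f A = 0\<rbrakk> \<Longrightarrow> q A = 0"
    and indep: "\<And>A c f. \<lbrakk>u A \<noteq> 0; \<forall>v. (\<Sum>f\<in>F. c f * differential f A v) = 0; f \<in> F\<rbrakk> \<Longrightarrow> c f = 0"
    using Fu unfolding generic_equations_def by blast+
  have "smooth_point (zariski_hull P) A" if A: "A \<in> zariski_hull P" "u A \<noteq> 0" for A
    unfolding smooth_point_def
  proof (intro conjI exI)
    show "openin zariski {A. u A \<noteq> 0}"
      using openin_zariski_nonvanishing u(1) .
    show "zariski_hull P \<inter> {A. u A \<noteq> 0} = {B \<in> {A. u A \<noteq> 0}. \<forall>f\<in>F. f B = 0}"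
      using F gen[OF _ dep] by (auto simp: zariski_hull_def)
  qed (use A F indep in auto)
  then show thesis
    using that u by blast
qed

section \<open>Conormal forms as gradients\<close>

text \<open>
  The matrix that represents the differential under the trace pairing.
\<close>

definition gradient :: "(complex^'m^'k \<Rightarrow> complex) \<Rightarrow> complex^'m^'k \<Rightarrow> complex^'k^'m" where
  "gradient f A = (\<chi> j i. differential f A (unit_matrix i j))"

lemma trace_mult: "trace (G ** v) = (\<Sum>j\<in>UNIV. \<Sum>i\<in>UNIV. G $ j $ i * v $ i $ j)"
  for G :: "complex^'k^'m" and v :: "complex^'m^'k"
  by (simp add: trace_def matrix_matrix_mult_def)

lemma trace_gradient:
  fixes f :: "complex^'m^'k \<Rightarrow> complex"
  assumes "poly_fun f"
  shows "trace (gradient f A ** v) = differential f A v"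
proof -
  interpret linear "differential f A" by (rule linear_differential[OF assms])
  have "v = (\<Sum>j\<in>UNIV. \<Sum>i\<in>UNIV. cscale (v $ i $ j) (unit_matrix i j))"
  proof -
    have "(\<Sum>j\<in>UNIV. \<Sum>i\<in>UNIV. cscale (v $ i $ j) (unit_matrix i j)) $ a $ b = v $ a $ b" for a b
    proof -
      have "(\<Sum>j\<in>UNIV. \<Sum>i\<in>UNIV. cscale (v $ i $ j) (unit_matrix i j)) $ a $ b
        = (\<Sum>j\<in>UNIV. \<Sum>i\<in>UNIV. if i = a then (if j = b then v $ i $ j else 0) else 0)"
        unfolding sum_component by (intro sum.cong refl) (auto simp: cscale_def unit_matrix_def)
      also have "\<dots> = v $ a $ b"
        by simp
      finally show ?thesis .
    qed
    then show ?thesis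
      by (simp add: vec_eq_iff)
  qed
  then have "differential f A v
    = differential f A (\<Sum>j\<in>UNIV. \<Sum>i\<in>UNIV. cscale (v $ i $ j) (unit_matrix i j))"
    by simp
  also have "\<dots> = trace (gradient f A ** v)"
    by (simp add: sum differential_cscale[OF assms] trace_mult gradient_def mult.commute)
  finally show ?thesis ..
qed

lemma trace_form_nondegenerate:
  fixes G H :: "complex^'k^'m"
  assumes "\<And>v :: complex^'m^'k. trace (G ** v) = trace (H ** v)"
  shows "G = H"
proof -
  have "trace (K ** unit_matrix i j) = K $ j $ i" for K :: "complex^'k^'m" and i j
  proof -
    have "trace (K ** unit_matrix i j)
        = (\<Sum>b\<in>UNIV. \<Sum>a\<in>UNIV. if a = i then (if b = j then K $ b $ a else 0) else 0)"
      unfolding trace_mult by (intro sum.cong refl) (auto simp: unit_matrix_def)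
    also have "\<dots> = K $ j $ i"
      by simp
    finally show ?thesis .
  qed
  then show ?thesis
    using assms by (metis vec_eq_iff)
qed

lemma poly_map_gradient: "poly_fun f \<Longrightarrow> poly_map (gradient f)"
  by (simp add: poly_map_def gradient_def poly_fun_differential)

lemma gradient_add: "poly_fun f \<Longrightarrow> poly_fun g \<Longrightarrow> gradient (\<lambda>A. f A + g A) A = gradient f A + gradient g A"
  by (simp add: gradient_def differential_add vec_eq_iff)

lemma gradient_cmult: "poly_fun f \<Longrightarrow> gradient (\<lambda>A. c * f A) A = cscale c (gradient f A)"
  using differential_mult[OF poly_fun.const[of c], of f]
  by (simp add: gradient_def differential_const vec_eq_iff cscale_def)

text \<open>
  The real inner product is the real part of the trace pairing after conjugation; this lets the real
  orthogonal decomposition produce complex annihilators.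
\<close>

lemma inner_eq_trace:
  fixes z K :: "complex^'k^'m"
  shows "inner z K = Re (trace (K ** (\<chi> i j. cnj (z $ j $ i))))"
  by (simp add: inner_vec_def trace_mult inner_complex_def algebra_simps)

lemma trace_mult_cscale: "trace (cscale c G ** v) = c * trace (G ** v)"
  by (simp add: trace_mult cscale_def sum_distrib_left mult.assoc)

text \<open>
  The forms that annihilate the tangent space are the span of the differentials of the polynomials
  vanishing on \<open>S\<close>. These polynomials form an ideal, hence their gradients at \<open>A\<close> are already a linear
  subspace, and one polynomial suffices. If \<open>g\<close> had a component \<open>z\<close> orthogonal to that subspace, then
  the conjugate transpose of \<open>z\<close> would be a tangent vector on which \<open>g\<close> is not zero.
\<close>

lemma conormal_is_gradient:
  fixes S :: "(complex^'m^'k) set"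
  assumes "\<forall>v\<in>tangent_space S A. trace (g ** v) = 0"
  obtains f where "poly_fun f" "\<forall>B\<in>S. f B = 0" "gradient f A = g"
proof -
  define G where "G = {gradient f A | f. poly_fun f \<and> (\<forall>B\<in>S. f B = 0)}"
  have GI: "gradient f A \<in> G" if "poly_fun f" "\<forall>B\<in>S. f B = 0" for f
    using that by (auto simp: G_def)
  have G_scale: "cscale c K \<in> G" if "K \<in> G" for c K
  proof -
    obtain f where f: "poly_fun f" "\<forall>B\<in>S. f B = 0" "K = gradient f A"
      using \<open>K \<in> G\<close> by (auto simp: G_def)
    then have "poly_fun (\<lambda>B. c * f B)" "\<forall>B\<in>S. c * f B = 0"
      by (auto intro: poly_fun.intros)
    then show ?thesis
      using GI[of "\<lambda>B. c * f B"] by (simp add: gradient_cmult f)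
  qed
  have "subspace G"
    unfolding subspace_def
  proof (intro conjI ballI allI)
    have "gradient (\<lambda>A. 0) A = 0"
      by (simp add: gradient_def differential_const vec_eq_iff)
    then show "0 \<in> G"
      using GI[of "\<lambda>A. 0"] poly_fun.const[of 0] by simp
  next
    fix K L assume "K \<in> G" "L \<in> G"
    then obtain f f' where f: "poly_fun f" "\<forall>B\<in>S. f B = 0" "K = gradient f A"
        and f': "poly_fun f'" "\<forall>B\<in>S. f' B = 0" "L = gradient f' A"
      unfolding G_def by blast
    then have "poly_fun (\<lambda>B. f B + f' B)" "\<forall>B\<in>S. f B + f' B = 0"
      by (auto intro: poly_fun.intros)
    then show "K + L \<in> G"
      using GI[of "\<lambda>B. f B + f' B"] by (simp add: gradient_add f f')
  qed (simp add: scaleR_eq_cscale G_scale)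
  obtain y z where y: "y \<in> G" and z: "\<And>w. w \<in> G \<Longrightarrow> orthogonal z w" and g: "g = y + z"
    using orthogonal_subspace_decomp_exists[of G g] \<open>subspace G\<close>
    by (metis span_eq_iff)
  define v where "v = (\<chi> i j. cnj (z $ j $ i))"
  have perp: "trace (K ** v) = 0" if "K \<in> G" for K
  proof (rule complex_eqI)
    show "Re (trace (K ** v)) = Re 0"
      using z[OF that] by (simp add: orthogonal_def inner_eq_trace v_def)
    \<comment> \<open>Multiplication by \<open>-\<i>\<close> moves the imaginary part of the trace into the real part.\<close>
    have "inner z (cscale (- \<i>) K) = 0"
      using z[OF G_scale[OF that]] by (simp add: orthogonal_def)
    then show "Im (trace (K ** v)) = Im 0"
      by (simp add: inner_eq_trace trace_mult_cscale v_def)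
  qed
  have "v \<in> tangent_space S A"
    unfolding tangent_space_def using perp GI trace_gradient by fastforce
  then have "trace (g ** v) = 0"
    using assms by blast
  then have "trace (z ** v) = 0"
    using perp[OF y] by (simp add: g trace_mult algebra_simps sum.distrib)
  then have "inner z z = 0"
    unfolding inner_eq_trace v_def[symmetric] by simp
  then show thesis
    using y that by (auto simp: g G_def)
qed

lemma gradient_is_conormal:
  assumes "poly_fun f" "\<forall>B\<in>S. f B = 0" "v \<in> tangent_space S A"
  shows "trace (gradient f A ** v) = 0"
  using assms trace_gradient[OF assms(1)] by (simp add: tangent_space_def)

lemma zariski_hull_vanishes: "poly_fun f \<Longrightarrow> \<forall>B\<in>P. f B = 0 \<Longrightarrow> \<forall>B\<in>zariski_hull P. f B = 0"
  by (simp add: zariski_hull_def)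

lemma zariski_hull_dense:
  "A \<in> zariski_hull P \<Longrightarrow> poly_fun f \<Longrightarrow> f A \<noteq> 0 \<Longrightarrow> \<exists>B\<in>P. f B \<noteq> 0"
  by (auto simp: zariski_hull_def)

text \<open>
  A conormal form at \<open>A\<close> is the value at \<open>A\<close> of the family \<open>B \<mapsto> gradient q B\<close>, which is conormal at every
  point of the closure of \<open>P\<close> when \<open>q\<close> vanishes on \<open>P\<close>. By irreducibility an open condition on the
  form that holds at \<open>A\<close> also holds somewhere in \<open>P\<close> at a smooth point.
\<close>

lemma perturb_conormal:
  fixes P :: "(complex^'m^'k) set"
  assumes "prime_locus P" "poly_fun q" "A \<in> zariski_hull P" "poly_fun w" "w (gradient q A) \<noteq> 0"
  obtains B where "B \<in> P" "smooth_point (zariski_hull P) B" "w (gradient q B) \<noteq> 0"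
proof -
  obtain u where u: "poly_fun u" "\<exists>B\<in>P. u B \<noteq> 0"
    "\<And>B. B \<in> zariski_hull P \<Longrightarrow> u B \<noteq> 0 \<Longrightarrow> smooth_point (zariski_hull P) B"
    using generic_smoothness[OF assms(1)] by blast
  have w: "poly_fun (\<lambda>B. w (gradient q B))"
    using poly_fun_compose[OF assms(4) poly_map_gradient[OF assms(2)]] .
  obtain B where "B \<in> P" "u B * w (gradient q B) \<noteq> 0"
    using assms(1) u(1,2) w zariski_hull_dense[OF assms(3) w assms(5)]
    unfolding prime_locus_def by blast
  then show thesis
    using that u(3) zariski_hull_superset[of P] by auto
qed

section \<open>Zariski closures in projective space\<close>

lemma cscale_zero_right [simp]: "cscale c 0 = 0"
  by (simp add: cscale_def vec_eq_iff)

lemma proj_class_nonzero: "A \<noteq> 0 \<Longrightarrow> proj_class A = proj_class B \<Longrightarrow> B \<noteq> 0"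
  by (metis cscale_zero_right proj_class_eq)

lemma proj_class_cscale:
  assumes "c \<noteq> 0"
  shows "proj_class (cscale c A) = proj_class A"
proof -
  have "cscale d A = cscale (d / c) (cscale c A)" for d
    using assms by (simp add: cscale_eq_mult)
  then have "proj_class A \<subseteq> proj_class (cscale c A)"
    unfolding proj_class_def by blast
  then show ?thesis
    unfolding proj_class_def by (auto simp: cscale_eq_mult)
qed

lemma proj_closure_iff:
  fixes A :: "complex^'m^'k"
  assumes "A \<noteq> 0"
  shows "proj_class A \<in> proj_zariski closure_of Z \<longleftrightarrow>
    (\<forall>f. poly_fun f \<and> (\<forall>B. B \<noteq> 0 \<and> proj_class B \<in> Z \<longrightarrow> f B = 0) \<longrightarrow> f A = 0)" (is "?L \<longleftrightarrow> ?R")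
proof
  assume ?L
  show ?R
  proof (intro allI impI; elim conjE; rule ccontr)
    fix f :: "complex^'m^'k \<Rightarrow> complex"
    assume f: "poly_fun f" "\<forall>B. B \<noteq> 0 \<and> proj_class B \<in> Z \<longrightarrow> f B = 0" "f A \<noteq> 0"
    obtain f' where f': "hom_poly f'" "f' A \<noteq> 0"
        "\<And>B. (\<And>c. c \<noteq> 0 \<Longrightarrow> f (cscale c B) = 0) \<Longrightarrow> f' B = 0"
      using homogeneous_components[OF f(1,3)] by blast
    let ?U = "proj_class ` {A. A \<noteq> 0 \<and> (\<exists>f\<in>{f'}. f A \<noteq> 0)}"
    have "openin proj_zariski ?U"
      unfolding openin_proj_zariski using f'(1) by (intro exI[of _ "{f'}"]) auto
    moreover have "proj_class A \<in> ?U"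
      using assms f'(2) by blast
    ultimately have "\<exists>y. y \<in> Z \<and> y \<in> ?U"
      using \<open>?L\<close>[unfolded in_closure_of, THEN conjunct2, rule_format, of ?U] by simp
    then obtain B where B: "B \<noteq> 0" "f' B \<noteq> 0" "proj_class B \<in> Z"
      by blast
    have "f (cscale c B) = 0" if "c \<noteq> 0" for c
    proof -
      have "proj_class (cscale c B) = proj_class B"
        using that by (rule proj_class_cscale)
      then show ?thesis
        using f(2) B proj_class_nonzero[of B "cscale c B"] by simp
    qed
    then show False
      using f'(3) B(2) by blast
  qed
next
  assume R: ?R
  show ?L
    unfolding in_closure_of
  proof (intro conjI allI impI)
    show "proj_class A \<in> topspace proj_zariski"
      using assms by (auto simp: proj_space_def)
    fix U assume U: "proj_class A \<in> U \<and> openin proj_zariski U"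
    then obtain S where S: "\<forall>f\<in>S. hom_poly f" "U = proj_class ` {A. A \<noteq> 0 \<and> (\<exists>f\<in>S. f A \<noteq> 0)}"
      unfolding openin_proj_zariski by blast
    then obtain C f where C: "proj_class A = proj_class C" "C \<noteq> 0" "f \<in> S" "f C \<noteq> 0"
      using U by blast
    then have "f A \<noteq> 0"
      using hom_poly_nonzero_class S(1) by metis
    then obtain B where "B \<noteq> 0" "proj_class B \<in> Z" "f B \<noteq> 0"
      using R S(1) C(3) unfolding hom_poly_def by blast
    then show "\<exists>y. y \<in> Z \<and> y \<in> U"
      using S(2) C(3) by blast
  qed
qed

section \<open>Matrices of full rank, their images and kernels\<close>

text \<open>
  If the range of \<open>h\<close> has dimension \<open>r\<close>, a linear section \<open>s\<close> of \<open>h\<close> makes \<open>s \<circ> h\<close> an endomorphism of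
  \<open>C\<^sup>r\<close> with full range, which is therefore injective.
\<close>

lemma full_rank_iff_left_inverse:
  fixes h :: "complex^'r^'n"
  shows "map_rank h = CARD('r) \<longleftrightarrow> (\<exists>p :: complex^'n^'r. p ** h = mat 1)"
proof -
  let ?f = "(*v) h"
  have lin: "Vector_Spaces.linear (*s) (*s) ?f"
    by (rule matrix_vector_mul_linear_gen)
  have "inj ?f" if rank: "vec.dim (range ?f) = CARD('r)"
  proof -
    obtain s where s: "Vector_Spaces.linear (*s) (*s) s" "\<forall>v\<in>range ?f. ?f (s v) = v"
      using vec.linear_exists_right_inverse_on[OF lin vec.subspace_UNIV] by blast
    have "vec.span (range ?f) = range ?f"
      using vec.linear_subspace_image[OF lin vec.subspace_UNIV] by (simp only: vec.span_eq_iff)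
    moreover have "inj_on s (range ?f)"
      using s(2) by (metis inj_onI)
    ultimately have "vec.dim (s ` range ?f) = CARD('r)"
      using vec.dim_image_eq[OF s(1), of "range ?f"] rank by metis
    then have "vec.span (s ` range ?f) = UNIV"
      by (metis vec.dim_eq_full vec_dim_card vec.dim_UNIV vec.dimension_def)
    moreover have sf: "Vector_Spaces.linear (*s) (*s) (s \<circ> ?f)"
      using Vector_Spaces.linear_compose[OF lin s(1)] .
    have "vec.span (range (s \<circ> ?f)) = range (s \<circ> ?f)"
      using vec.linear_subspace_image[OF sf vec.subspace_UNIV] by (simp only: vec.span_eq_iff)
    ultimately have "surj (s \<circ> ?f)"
      by (simp add: image_comp)
    then have "inj (s \<circ> ?f)"
      using vec.linear_surj_imp_inj[OF sf] by blast
    then show ?thesis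
      by (rule inj_on_imageI2)
  qed
  moreover have "vec.dim (range ?f) = CARD('r)" if "inj ?f"
    using vec.dim_image_eq[OF lin, of UNIV] that by (simp add: card_cart_basis)
  ultimately show ?thesis
    unfolding map_rank_def matrix_left_invertible_injective by blast
qed

lemma full_rank_iff_right_inverse:
  fixes g :: "complex^'n^'r"
  shows "map_rank g = CARD('r) \<longleftrightarrow> (\<exists>j :: complex^'r^'n. g ** j = mat 1)"
proof -
  let ?f = "(*v) g"
  have lin: "Vector_Spaces.linear (*s) (*s) ?f"
    by (rule matrix_vector_mul_linear_gen)
  have "vec.span (range ?f) = range ?f"
    using vec.linear_subspace_image[OF lin vec.subspace_UNIV] by (simp only: vec.span_eq_iff)
  moreover have "vec.dim (range ?f) = CARD('r) \<longleftrightarrow> vec.span (range ?f) = UNIV"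
    by (metis vec.dim_eq_full vec_dim_card vec.dim_UNIV vec.dimension_def)
  ultimately show ?thesis
    unfolding map_rank_def matrix_right_invertible_surjective by metis
qed

lemma grass_frame:
  fixes L :: "(complex^'n) set"
  assumes "L \<in> grass CARD('r)"
  obtains h :: "complex^'r^'n" where "map_rank h = CARD('r)" "range ((*v) h) = L"
proof -
  have L: "vec.subspace L" "vec.dim (UNIV :: (complex^'r) set) = vec.dim L"
    using assms by (auto simp: grass_def card_cart_basis)
  obtain f :: "complex^'r \<Rightarrow> complex^'n" where f: "Vector_Spaces.linear (*s) (*s) f" "range f = L"
    using vec.subspace_isomorphism[OF vec.subspace_UNIV L] by blast
  then have "(*v) (matrix f) = f"
    using matrix_works by blast
  then show thesis
    using that[of "matrix f"] f(2) assms by (simp only: map_rank_def grass_def mem_Collect_eq)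
qed

lemma range_in_grass: "map_rank h = k \<Longrightarrow> range ((*v) h) \<in> grass k"
  using vec.linear_subspace_image[OF matrix_vector_mul_linear_gen vec.subspace_UNIV]
  by (auto simp: grass_def map_rank_def)

lemma subspace_kernel: "vec.subspace (kernel g)"
  by (simp add: vec.subspace_def kernel_def matrix_vector_right_distrib)
    (metis matrix_vector_mult_0_right vec.scale vec.scale_zero_right)

lemma kernel_in_grass:
  fixes g :: "complex^'n^'r"
  assumes "map_rank g = CARD('r)"
  shows "kernel g \<in> grass (CARD('n) - CARD('r))"
proof -
  obtain j :: "complex^'r^'n" where j: "g ** j = mat 1"
    using assms full_rank_iff_right_inverse by blast
  have "vec.dim (range ((*v) j)) = CARD('r)"
    using full_rank_iff_left_inverse[of j] j by (auto simp: map_rank_def)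
  moreover have "{x + y | x y. x \<in> kernel g \<and> y \<in> range ((*v) j)} = UNIV"
  proof -
    have "v = (v - j *v (g *v v)) + j *v (g *v v)" "v - j *v (g *v v) \<in> kernel g" for v
      using j by (simp_all add: kernel_def matrix_vector_mult_diff_distrib matrix_vector_mul_assoc matrix_mul_assoc)
    then show ?thesis by blast
  qed
  moreover have "kernel g \<inter> range ((*v) j) = {0}"
    using j by (auto simp: kernel_def matrix_vector_mul_assoc image_iff intro!: exI[of _ 0])
  moreover have "vec.subspace (range ((*v) j))"
    using vec.linear_subspace_image[OF matrix_vector_mul_linear_gen vec.subspace_UNIV] .
  ultimately have "vec.dim (kernel g) + CARD('r) = CARD('n)"
    using vec.dim_sums_Int[OF subspace_kernel[of g], of "range ((*v) j)"]
    by (simp add: card_cart_basis)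
  then show ?thesis
    using subspace_kernel[of g] by (simp add: grass_def)
qed

section \<open>Frames and charts of the Grassmannian\<close>

lemma matrix_add_mult: "(A + B) ** C = A ** C + B ** C" for A B :: "complex^'m^'k"
  by (simp add: matrix_matrix_mult_def vec_eq_iff algebra_simps sum.distrib)

lemma matrix_diff_mult: "(A - B) ** C = A ** C - B ** C" for A B :: "complex^'m^'k"
  by (simp add: matrix_matrix_mult_def vec_eq_iff algebra_simps sum_subtractf)

lemma matrix_mult_diff: "C ** (A - B) = C ** A - C ** B" for A B :: "complex^'m^'k"
  by (simp add: matrix_matrix_mult_def vec_eq_iff algebra_simps sum_subtractf)

lemma matrix_zero_mult [simp]: "0 ** C = (0 :: complex^'p^'k)" for C :: "complex^'p^'m"
  by (simp add: matrix_matrix_mult_def vec_eq_iff)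

lemma matrix_mult_zero [simp]: "C ** 0 = (0 :: complex^'p^'k)" for C :: "complex^'m^'k"
  by (simp add: matrix_matrix_mult_def vec_eq_iff)

lemma cscale_mult: "cscale c (A ** B) = cscale c A ** B"
  by (simp add: matrix_matrix_mult_def cscale_def vec_eq_iff sum_distrib_left mult.assoc)

lemma mult_cscale: "A ** cscale c B = cscale c (A ** B)"
  by (simp add: matrix_matrix_mult_def cscale_def vec_eq_iff sum_distrib_left mult.left_commute)

lemmas matrix_distribs = matrix_add_mult matrix_add_ldistrib matrix_diff_mult matrix_mult_diff

lemma matrix_eqI: "(\<And>v. A *v v = B *v v) \<Longrightarrow> A = B" for A B :: "complex^'m^'k"
  by (simp add: matrix_eq)

text \<open>
  The affine version of \<open>pi_preimage X\<close>: the bases of the members of \<open>X\<close>, a principal bundle over \<open>X\<close>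
  under the general linear group of \<open>C\<^sup>r\<close>.
\<close>

definition frames :: "(complex^'n) set set \<Rightarrow> (complex^'r^'n) set" where
  "frames X = {h. map_rank h = CARD('r) \<and> range ((*v) h) \<in> X}"

lemma frame_reproduces: "p ** h = mat 1 \<Longrightarrow> l \<in> range ((*v) h) \<Longrightarrow> h *v (p *v l) = l"
  by (auto simp: matrix_vector_mul_assoc matrix_mul_assoc[symmetric])

lemma frame_mult_reproduces:
  fixes p :: "complex^'n^'r" and h :: "complex^'r^'n" and B :: "complex^'m^'n"
  assumes "p ** h = mat 1" "\<And>v. B *v v \<in> range ((*v) h)"
  shows "h ** (p ** B) = B"
  by (rule matrix_eqI) (metis assms frame_reproduces matrix_vector_mul_assoc)

lemma complementary_range_kernel:
  fixes h :: "complex^'r^'n"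
  assumes "p ** h = mat 1"
  shows "complementary (range ((*v) h)) (kernel p)"
  unfolding complementary_def
proof (intro conjI allI)
  show "vec.subspace (range ((*v) h))"
    using vec.linear_subspace_image[OF matrix_vector_mul_linear_gen vec.subspace_UNIV] .
  have "l = 0" if "l \<in> range ((*v) h)" "l \<in> kernel p" for l
    using frame_reproduces[OF assms that(1)] that(2) by (simp add: kernel_def)
  moreover have "0 \<in> range ((*v) h)"
    by (metis matrix_vector_mult_0_right rangeI)
  ultimately show "range ((*v) h) \<inter> kernel p = {0}"
    by (auto simp: kernel_def)
  fix v
  have "v = h *v (p *v v) + (v - h *v (p *v v))" "v - h *v (p *v v) \<in> kernel p"
    using assms by (simp_all add: kernel_def matrix_vector_mult_diff_distrib matrix_vector_mul_assoc matrix_mul_assoc)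
  then show "\<exists>l\<in>range ((*v) h). \<exists>w\<in>kernel p. v = l + w"
    by blast
qed (rule subspace_kernel)

text \<open>
  A left inverse \<open>p\<close> of \<open>h\<close> encodes a complement of the image of \<open>h\<close>, namely the kernel of \<open>p\<close>, and the
  projection \<open>h p\<close> along it. In these terms the chart space is given by linear matrix equations.
\<close>

lemma chart_space_iff:
  fixes h :: "complex^'r^'n"
  assumes "p ** h = mat 1"
  shows "A \<in> chart_space (range ((*v) h)) (kernel p) \<longleftrightarrow> p ** A = 0 \<and> A = A ** h ** p"
proof
  assume A: "A \<in> chart_space (range ((*v) h)) (kernel p)"
  have "(p ** A) *v v = 0 *v v" for v
    using A by (simp add: chart_space_def kernel_def matrix_vector_mul_assoc)
  moreover have "A *v v = (A ** h ** p) *v v" for v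
  proof -
    have "v - h *v (p *v v) \<in> kernel p"
      using assms by (simp add: kernel_def matrix_vector_mult_diff_distrib matrix_vector_mul_assoc matrix_mul_assoc)
    then have "A *v (v - h *v (p *v v)) = 0"
      using A by (simp add: chart_space_def)
    then show ?thesis
      by (simp add: matrix_vector_mult_diff_distrib matrix_vector_mul_assoc matrix_mul_assoc)
  qed
  ultimately show "p ** A = 0 \<and> A = A ** h ** p"
    by (intro conjI matrix_eqI)
next
  assume A: "p ** A = 0 \<and> A = A ** h ** p"
  have "A *v v \<in> kernel p" for v
    using A by (simp add: kernel_def matrix_vector_mul_assoc)
  moreover have "A *v w = 0" if "w \<in> kernel p" for w
  proof -
    have "A *v w = (A ** h) *v (p *v w)"
      using A by (simp add: matrix_vector_mul_assoc)
    then show ?thesis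
      using that by (simp add: kernel_def)
  qed
  ultimately show "A \<in> chart_space (range ((*v) h)) (kernel p)"
    by (simp add: chart_space_def)
qed

lemma chart_range: "chart (range ((*v) h)) A = range ((*v) (h + A ** h))"
  by (simp add: chart_def image_image matrix_vector_mult_add_rdistrib matrix_vector_mul_assoc)

lemma range_mult_invertible:
  fixes m :: "complex^'r^'r"
  assumes "m ** a = mat 1"
  shows "range ((*v) (h ** m)) = range ((*v) h)"
proof -
  have "h *v x = (h ** m) *v (a *v x)" for x
    using assms by (simp add: matrix_vector_mul_assoc matrix_mul_assoc[symmetric])
  then show ?thesis
    by (auto simp: matrix_vector_mul_assoc[symmetric])
qed

text \<open>
  A frame \<open>h'\<close> with \<open>p h'\<close> invertible can be normalized to \<open>h' a\<close> with \<open>p h' a = 1\<close>, which has the form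
  \<open>h + A h\<close> for \<open>A\<close> in the chart space. So the chart coordinate of the image of \<open>h'\<close> is a rational
  function of \<open>h'\<close>.
\<close>

lemma frame_in_chart:
  fixes h h' :: "complex^'r^'n"
  assumes p: "p ** h = mat 1" and a: "(p ** h') ** a = mat 1"
  defines "A \<equiv> (mat 1 - h ** p) ** h' ** a ** p"
  shows "A \<in> chart_space (range ((*v) h)) (kernel p)"
    and "chart (range ((*v) h)) A = range ((*v) h')"
    and "map_rank h' = CARD('r)"
proof -
  have a': "a ** (p ** h') = mat 1"
    using a matrix_left_right_inverse by blast
  have "p ** A = 0"
    using p by (simp add: A_def matrix_mul_assoc matrix_distribs)
  moreover have "A ** h ** p = A"
  proof -
    have "A ** h = (mat 1 - h ** p) ** h' ** a"
      unfolding A_def by (simp add: p matrix_mul_assoc[symmetric])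
    then show ?thesis
      by (simp add: A_def)
  qed
  ultimately show "A \<in> chart_space (range ((*v) h)) (kernel p)"
    using chart_space_iff[OF p] by metis
  have "h + A ** h = h' ** a"
  proof -
    have "A ** h = (mat 1 - h ** p) ** h' ** a"
      unfolding A_def by (simp add: p matrix_mul_assoc[symmetric])
    also have "\<dots> = h' ** a - h ** ((p ** h') ** a)"
      by (simp add: matrix_distribs matrix_mul_assoc)
    finally show ?thesis
      using a by simp
  qed
  then show "chart (range ((*v) h)) A = range ((*v) h')"
    using range_mult_invertible[OF a'] by (simp add: chart_range)
  show "map_rank h' = CARD('r)"
    using a' full_rank_iff_left_inverse by (metis matrix_mul_assoc)
qed

lemma origin_in_chart:
  assumes "vec.subspace W" "L \<in> X"
  shows "0 \<in> in_chart X L W"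
  using assms by (simp add: in_chart_def chart_space_def chart_def vec.subspace_0)

text \<open>
  The map from frames to subspaces is continuous: pull back a polynomial in the chart centred at the
  image of \<open>h\<close> along the rational coordinates and clear the denominator.
\<close>

lemma image_continuous:
  fixes h :: "complex^'r^'n"
  assumes U: "openin (grass_zariski CARD('r)) U" and h: "map_rank h = CARD('r)" "range ((*v) h) \<in> U"
  obtains w where "poly_fun w" "w h \<noteq> 0"
    "\<And>h' :: complex^'r^'n. w h' \<noteq> 0 \<Longrightarrow> map_rank h' = CARD('r) \<and> range ((*v) h') \<in> U"
proof -
  obtain p :: "complex^'n^'r" where p: "p ** h = mat 1"
    using h(1) full_rank_iff_left_inverse by blast
  let ?L = "range ((*v) h)" and ?W = "kernel p"
  have "openin (subtopology zariski (chart_space ?L ?W)) (in_chart U ?L ?W)"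
    using U complementary_range_kernel[OF p] range_in_grass[OF h(1)] by (simp add: openin_grass_zariski)
  then obtain T where T: "openin zariski T" "in_chart U ?L ?W = T \<inter> chart_space ?L ?W"
    by (auto simp: openin_subtopology)
  moreover have "0 \<in> in_chart U ?L ?W"
    using origin_in_chart[OF subspace_kernel h(2)] .
  ultimately obtain z where z: "poly_fun z" "z 0 \<noteq> 0" "\<And>A. z A \<noteq> 0 \<Longrightarrow> A \<in> T"
    unfolding openin_zariski by auto
  define s where "s h' = det (p ** h')" for h' :: "complex^'r^'n"
  define N where "N h' = (mat 1 - h ** p) ** h' ** adjugate (p ** h') ** p" for h' :: "complex^'r^'n"
  have s: "poly_fun s"
    unfolding s_def by (intro poly_fun_det poly_map_intros)
  have N: "poly_map N"
    unfolding N_def by (intro poly_map_intros)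
  obtain e q where q: "poly_fun q" "\<And>h'. s h' \<noteq> 0 \<Longrightarrow> q h' = s h' ^ e * z (cscale (1 / s h') (N h'))"
    using clear_denominator[OF z(1) N s] by blast
  have "map_rank h' = CARD('r) \<and> range ((*v) h') \<in> U" if "s h' * q h' \<noteq> 0" for h'
  proof -
    define a where "a = cscale (1 / s h') (adjugate (p ** h'))"
    have sz: "s h' \<noteq> 0"
      using that by auto
    then have a: "(p ** h') ** a = mat 1"
      unfolding a_def s_def by (rule mult_adjugate)
    have "cscale (1 / s h') (N h') = (mat 1 - h ** p) ** h' ** a ** p"
      by (simp add: N_def a_def mult_cscale cscale_mult[symmetric])
    moreover have "cscale (1 / s h') (N h') \<in> T"
      using that q(2)[OF sz] z(3) by auto
    ultimately have "(mat 1 - h ** p) ** h' ** a ** p \<in> in_chart U ?L ?W"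
      using T(2) frame_in_chart(1)[OF p a] by simp
    then show ?thesis
      using frame_in_chart(2,3)[OF p a] by (simp add: in_chart_def)
  qed
  moreover have "s h * q h \<noteq> 0"
  proof -
    have "s h = 1"
      by (simp add: s_def p)
    moreover have "N h = 0"
      by (simp add: N_def matrix_distribs matrix_mul_assoc[symmetric] p)
    ultimately show ?thesis
      using q(2)[of h] z(2) by simp
  qed
  ultimately show thesis
    using that[of "\<lambda>h. s h * q h"] s q(1) poly_fun.mult by blast
qed

text \<open>
  A right inverse \<open>j\<close> of \<open>g\<close> encodes a complement of the kernel of \<open>g\<close>, and if \<open>g' j\<close> is invertible,
  solving \<open>g' (k + j y) = 0\<close> for \<open>y\<close> exhibits the kernel of \<open>g'\<close> as a graph over that of \<open>g\<close>.
\<close>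

lemma kernel_in_chart:
  fixes g g' :: "complex^'n^'r"
  assumes j: "g ** j = mat 1" and a: "(g' ** j) ** a = mat 1"
  defines "A \<equiv> - (j ** a ** g' ** (mat 1 - j ** g))"
  shows "A \<in> chart_space (kernel g) (range ((*v) j))"
    and "chart (kernel g) A = kernel g'"
    and "map_rank g' = CARD('r)"
proof -
  have a': "a ** (g' ** j) = mat 1"
    using a matrix_left_right_inverse by blast
  have minus: "(- B) *v v = - (B *v v)" for B :: "complex^'n^'n" and v
    by (simp add: matrix_vector_mult_def vec_eq_iff sum_negf)
  have A: "A *v v = j *v (- (a *v (g' *v (v - j *v (g *v v)))))" for v
    unfolding A_def minus
    by (simp add: vec.neg matrix_vector_mult_diff_rdistrib matrix_vector_mul_assoc[symmetric])
  have gj: "g *v (j *v y) = y" "a *v (g' *v (j *v y)) = y" "g' *v (j *v (a *v y)) = y" for y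
    using j a a' by (simp_all add: matrix_vector_mul_assoc matrix_mul_assoc)
  show "A \<in> chart_space (kernel g) (range ((*v) j))"
    unfolding chart_space_def using A gj by auto
  show "chart (kernel g) A = kernel g'"
  proof (intro set_eqI iffI)
    fix v assume "v \<in> chart (kernel g) A"
    then obtain k where "g *v k = 0" "v = k + A *v k"
      by (auto simp: chart_def kernel_def)
    then show "v \<in> kernel g'"
      using gj by (simp add: kernel_def A matrix_vector_mult_diff_distrib matrix_vector_right_distrib vec.neg)
  next
    fix v assume v: "v \<in> kernel g'"
    let ?k = "v - j *v (g *v v)"
    have "g *v ?k = 0"
      using gj by (simp add: matrix_vector_mult_diff_distrib)
    moreover have "A *v ?k = j *v (g *v v)"
      using gj v calculation by (simp add: A kernel_def matrix_vector_mult_diff_distrib vec.neg)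
    ultimately show "v \<in> chart (kernel g) A"
      unfolding chart_def kernel_def by (intro image_eqI[of _ _ ?k]) auto
  qed
  show "map_rank g' = CARD('r)"
    using a full_rank_iff_right_inverse by (metis matrix_mul_assoc)
qed

lemma complementary_kernel_range:
  fixes g :: "complex^'n^'r"
  assumes "g ** j = mat 1"
  shows "complementary (kernel g) (range ((*v) j))"
proof -
  have "complementary (range ((*v) j)) (kernel g)"
    using complementary_range_kernel[OF assms] .
  then show ?thesis
    unfolding complementary_def by (metis Int_commute add.commute)
qed

text \<open>
  The analogue of \<open>image_continuous\<close> for \<open>\<pi>'\<close>, with the same clearing of denominators.
\<close>

lemma kernel_continuous:
  fixes g :: "complex^'n^'r"
  assumes U: "openin (grass_zariski (CARD('n) - CARD('r))) U" and g: "map_rank g = CARD('r)" "kernel g \<in> U"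
  obtains w where "poly_fun w" "w g \<noteq> 0"
    "\<And>g' :: complex^'n^'r. w g' \<noteq> 0 \<Longrightarrow> map_rank g' = CARD('r) \<and> kernel g' \<in> U"
proof -
  obtain j :: "complex^'r^'n" where j: "g ** j = mat 1"
    using g(1) full_rank_iff_right_inverse by blast
  let ?L = "kernel g" and ?W = "range ((*v) j)"
  have W: "complementary ?L ?W"
    using complementary_kernel_range[OF j] .
  then have "openin (subtopology zariski (chart_space ?L ?W)) (in_chart U ?L ?W)"
    using U kernel_in_grass[OF g(1)] by (simp add: openin_grass_zariski)
  then obtain T where T: "openin zariski T" "in_chart U ?L ?W = T \<inter> chart_space ?L ?W"
    by (auto simp: openin_subtopology)
  moreover have "0 \<in> in_chart U ?L ?W"
    using origin_in_chart[of ?W ?L U] W g(2) by (simp add: complementary_def)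
  ultimately obtain z where z: "poly_fun z" "z 0 \<noteq> 0" "\<And>A. z A \<noteq> 0 \<Longrightarrow> A \<in> T"
    unfolding openin_zariski by auto
  define s where "s g' = det (g' ** j)" for g' :: "complex^'n^'r"
  define N where "N g' = - (j ** adjugate (g' ** j) ** g' ** (mat 1 - j ** g))" for g' :: "complex^'n^'r"
  have s: "poly_fun s"
    unfolding s_def by (intro poly_fun_det poly_map_intros)
  have N: "poly_map N"
    unfolding N_def by (intro poly_map_intros)
  obtain e q where q: "poly_fun q" "\<And>g'. s g' \<noteq> 0 \<Longrightarrow> q g' = s g' ^ e * z (cscale (1 / s g') (N g'))"
    using clear_denominator[OF z(1) N s] by blast
  have "map_rank g' = CARD('r) \<and> kernel g' \<in> U" if "s g' * q g' \<noteq> 0" for g'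
  proof -
    define a where "a = cscale (1 / s g') (adjugate (g' ** j))"
    have sz: "s g' \<noteq> 0"
      using that by auto
    then have a: "(g' ** j) ** a = mat 1"
      unfolding a_def s_def by (rule mult_adjugate)
    have neg: "cscale c (- B) = - cscale c B" for c and B :: "complex^'n^'n"
      by (simp add: cscale_def vec_eq_iff)
    have "cscale (1 / s g') (N g') = - (j ** a ** g' ** (mat 1 - j ** g))"
      by (simp add: N_def a_def mult_cscale cscale_mult[symmetric] neg)
    moreover have "cscale (1 / s g') (N g') \<in> T"
      using that q(2)[OF sz] z(3) by auto
    ultimately have "- (j ** a ** g' ** (mat 1 - j ** g)) \<in> in_chart U ?L ?W"
      using T(2) kernel_in_chart(1)[OF j a] by simp
    then show ?thesis
      using kernel_in_chart(2,3)[OF j a] by (simp add: in_chart_def)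
  qed
  moreover have "s g * q g \<noteq> 0"
  proof -
    have "s g = 1"
      by (simp add: s_def j)
    moreover have "N g = 0"
      by (simp add: N_def matrix_distribs matrix_mul_assoc j) (simp add: matrix_mul_assoc[symmetric] j)
    ultimately show ?thesis
      using q(2)[of g] z(2) by simp
  qed
  ultimately show thesis
    using that[of "\<lambda>g. s g * q g"] s q(1) poly_fun.mult by blast
qed

section \<open>The space of frames over a subvariety\<close>

text \<open>
  Closing up \<open>frames X\<close> adds only matrices of lower rank, since \<open>X\<close> is closed and the image depends
  continuously on the frame.
\<close>

lemma frames_closed:
  fixes h :: "complex^'r^'n"
  assumes "closedin (grass_zariski CARD('r)) X" "h \<in> zariski_hull (frames X)" "map_rank h = CARD('r)"
  shows "h \<in> frames X"
proof (rule ccontr)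
  assume "h \<notin> frames X"
  then have "range ((*v) h) \<in> grass CARD('r) - X"
    using assms(3) range_in_grass[OF assms(3)] by (simp add: frames_def)
  moreover have "openin (grass_zariski CARD('r)) (grass CARD('r) - X)"
    using assms(1) by (simp add: closedin_def)
  ultimately obtain w where w: "poly_fun w" "w h \<noteq> 0"
    "\<And>h' :: complex^'r^'n. w h' \<noteq> 0 \<Longrightarrow> range ((*v) h') \<in> grass CARD('r) - X"
    using image_continuous[OF _ assms(3)] by metis
  then have "\<forall>h'\<in>frames X. w h' = 0"
    unfolding frames_def by blast
  then show False
    using assms(2) w(1,2) by (auto simp: zariski_hull_def)
qed

lemma frames_of_same_space:
  fixes h k :: "complex^'r^'n"
  assumes "map_rank h = CARD('r)" "map_rank k = CARD('r)" "range ((*v) h) = range ((*v) k)"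
  obtains m where "det m \<noteq> 0" "h = k ** m"
proof -
  obtain p :: "complex^'n^'r" where p: "p ** k = mat 1"
    using assms(2) full_rank_iff_left_inverse by blast
  obtain p' :: "complex^'n^'r" where p': "p' ** h = mat 1"
    using assms(1) full_rank_iff_left_inverse by blast
  have h: "k ** (p ** h) = h"
    using frame_mult_reproduces[OF p, of h] assms(3) by blast
  have k: "h ** (p' ** k) = k"
    using frame_mult_reproduces[OF p', of k] assms(3) by blast
  have "(p' ** k) ** (p ** h) = p' ** (k ** (p ** h))"
    by (simp add: matrix_mul_assoc)
  then have "(p' ** k) ** (p ** h) = mat 1"
    using h p' by simp
  then have "det (p ** h) \<noteq> 0"
    using invertible_det_nz invertible_left_inverse by blast
  then show thesis
    using that h by metis
qed

lemma frame_mult: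
  fixes h :: "complex^'r^'n"
  assumes "map_rank h = CARD('r)" "det m \<noteq> 0"
  shows "range ((*v) (h ** m)) = range ((*v) h)" "map_rank (h ** m) = CARD('r)"
proof -
  show "range ((*v) (h ** m)) = range ((*v) h)"
    using range_mult_invertible[OF mult_adjugate[OF assms(2)]] .
  then show "map_rank (h ** m) = CARD('r)"
    using assms(1) by (simp add: map_rank_def)
qed

text \<open>
  The map from frames to subspaces is open: in a chart, the image of the set \<open>f \<noteq> 0\<close> is the union over
  all invertible \<open>m\<close> of the sets where \<open>f ((h + A h) m) \<noteq> 0\<close>.
\<close>

lemma openin_image_nonvanishing:
  fixes f :: "complex^'r^'n \<Rightarrow> complex"
  assumes "poly_fun f"
  shows "openin (grass_zariski CARD('r)) {range ((*v) h) | h. map_rank h = CARD('r) \<and> f h \<noteq> 0}" (is "openin _ ?U")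
  unfolding openin_grass_zariski
proof (intro conjI allI impI; (elim conjE)?)
  show "?U \<subseteq> grass CARD('r)"
    using range_in_grass by blast
  fix L W :: "(complex^'n) set"
  assume L: "L \<in> grass CARD('r)" and W: "complementary L W"
  obtain h :: "complex^'r^'n" where h: "map_rank h = CARD('r)" "range ((*v) h) = L"
    using grass_frame[OF L] .
  let ?S = "{\<lambda>A. f ((h + A ** h) ** m) | m. det m \<noteq> 0}"
  let ?T = "{A. \<exists>z\<in>?S. z A \<noteq> 0}"
  have "poly_fun (\<lambda>A. f ((h + A ** h) ** m))" for m
    by (rule poly_fun_compose[OF assms]) (intro poly_map_intros)
  then have "openin zariski ?T"
    unfolding openin_zariski by (intro exI[of _ ?S]) auto
  moreover have "in_chart ?U L W = ?T \<inter> chart_space L W"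
  proof (intro set_eqI)
    fix A
    let ?k = "h + A ** h"
    have "chart L A \<in> ?U \<longleftrightarrow> A \<in> ?T" if A: "A \<in> chart_space L W"
    proof -
      have chart: "chart L A = range ((*v) ?k)"
        using chart_range h(2) by metis
      then have k: "map_rank ?k = CARD('r)"
        using chart_in_grass[OF L W A] by (simp add: grass_def map_rank_def)
      show ?thesis
      proof
        assume "chart L A \<in> ?U"
        then obtain h' where h': "chart L A = range ((*v) h')" "map_rank h' = CARD('r)" "f h' \<noteq> 0"
          by blast
        obtain m where "det m \<noteq> 0" "h' = ?k ** m"
          using frames_of_same_space[OF h'(2) k] h'(1) chart by metis
        then have "f (?k ** m) \<noteq> 0"
          using h'(3) by simp
        then show "A \<in> ?T"
          using \<open>det m \<noteq> 0\<close> by auto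
      next
        assume "A \<in> ?T"
        then obtain m where m: "det m \<noteq> 0" "f (?k ** m) \<noteq> 0"
          by auto
        then show "chart L A \<in> ?U"
          using frame_mult[OF k m(1)] chart by (metis (mono_tags, lifting) mem_Collect_eq)
      qed
    qed
    then show "A \<in> in_chart ?U L W \<longleftrightarrow> A \<in> ?T \<inter> chart_space L W"
      by (cases "A \<in> chart_space L W") (simp_all only: in_chart_def mem_Collect_eq Int_iff simp_thms)
  qed
  ultimately show "openin (subtopology zariski (chart_space L W)) (in_chart ?U L W)"
    unfolding openin_subtopology by blast
qed

text \<open>
  The total space of a bundle with irreducible base and fibres is irreducible when the projection is
  open: the images of two nonempty open sets meet in \<open>X\<close>, and over a common point both open sets meet
  the fibre, which is a copy of the invertible matrices and so irreducible.
\<close>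

lemma prime_locus_frames:
  assumes X: "irreducible_in (grass_zariski CARD('r)) X" and sub: "X \<subseteq> grass CARD('r)"
  shows "prime_locus (frames X :: (complex^'r^'n) set)"
  unfolding prime_locus_def
proof (intro conjI allI impI)
  obtain L where "L \<in> X"
    using X by (auto simp: irreducible_in_def)
  then obtain h :: "complex^'r^'n" where "map_rank h = CARD('r)" "range ((*v) h) = L"
    using grass_frame sub by blast
  then show "(frames X :: (complex^'r^'n) set) \<noteq> {}"
    using \<open>L \<in> X\<close> by (auto simp: frames_def)
next
  fix f g :: "complex^'r^'n \<Rightarrow> complex"
  assume f: "poly_fun f" "\<exists>A\<in>frames X. f A \<noteq> 0" and g: "poly_fun g" "\<exists>A\<in>frames X. g A \<noteq> 0"
  define U where "U f = {range ((*v) h) | h. map_rank h = CARD('r) \<and> f h \<noteq> 0}"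
    for f :: "complex^'r^'n \<Rightarrow> complex"
  have closed: "closedin (grass_zariski CARD('r)) (grass CARD('r) - U f)" if "poly_fun f"
    for f :: "complex^'r^'n \<Rightarrow> complex"
  proof -
    have "openin (grass_zariski CARD('r)) (U f)"
      unfolding U_def using openin_image_nonvanishing[OF that] .
    from closedin_diff[OF closedin_topspace this] show ?thesis
      by simp
  qed
  have meets: "\<not> X \<subseteq> grass CARD('r) - U f" if "\<exists>A\<in>frames X. f A \<noteq> 0" for f :: "complex^'r^'n \<Rightarrow> complex"
    using that unfolding U_def frames_def by blast
  have "\<not> X \<subseteq> (grass CARD('r) - U f) \<union> (grass CARD('r) - U g)"
    using X[unfolded irreducible_in_def, THEN conjunct2, rule_format, OF conjI, OF _ conjI]
      closed[OF f(1)] closed[OF g(1)] meets[OF f(2)] meets[OF g(2)] by metis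
  then obtain L where L: "L \<in> X" "L \<in> U f" "L \<in> U g"
    using sub by blast
  obtain h where h: "L = range ((*v) h)" "map_rank h = CARD('r)" "f h \<noteq> 0"
    using L(2) by (auto simp: U_def)
  obtain k where k: "L = range ((*v) k)" "map_rank k = CARD('r)" "g k \<noteq> 0"
    using L(3) by (auto simp: U_def)
  obtain m where m: "det m \<noteq> 0" "k = h ** m"
    using frames_of_same_space[OF k(2) h(2)] h(1) k(1) by metis
  have fm: "poly_fun (\<lambda>m. f (h ** m))"
    by (rule poly_fun_compose[OF f(1)]) (intro poly_map_intros)
  have gm: "poly_fun (\<lambda>m. g (h ** m))"
    by (rule poly_fun_compose[OF g(1)]) (intro poly_map_intros)
  have dm: "poly_fun (\<lambda>m :: complex^'r^'r. det m)"
    by (intro poly_fun_det poly_map_intros)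
  \<comment> \<open>On the fibre \<open>h m\<close> the polynomials \<open>f\<close>, \<open>g\<close> and the determinant are nonzero, hence so is their product.\<close>
  obtain m' where "f (h ** m') * g (h ** m') \<noteq> 0"
    using poly_fun_nonzero_mult[OF fm gm, of "mat 1" m] h(3) k(3) m by auto
  then obtain m'' where "f (h ** m'') * g (h ** m'') * det m'' \<noteq> 0"
    using poly_fun_nonzero_mult[OF poly_fun.mult[OF fm gm] dm, of m' m] m(1) by auto
  then have "h ** m'' \<in> frames X" "f (h ** m'') * g (h ** m'') \<noteq> 0"
    using frame_mult[OF h(2), of m''] h(1) L(1) by (auto simp: frames_def)
  then show "\<exists>A\<in>frames X. f A * g A \<noteq> 0"
    by blast
qed

text \<open>
  The curve \<open>h (1 + t m)\<close> consists of frames of the same subspace for small \<open>t\<close>. So the tangent space of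
  the cone at \<open>h\<close> contains all matrices with image in that of \<open>h\<close>.
\<close>

lemma differential_along_fibre:
  fixes h :: "complex^'r^'n"
  assumes "poly_fun f" "\<forall>B\<in>frames X. f B = 0" "h \<in> frames X"
  shows "differential f h (h ** m) = 0"
proof -
  have "poly_fun (\<lambda>m :: complex^'r^'r. det m)"
    by (intro poly_fun_det poly_map_intros)
  then have "((\<lambda>t::real. det (mat 1 + t *\<^sub>R m)) \<longlongrightarrow> det (mat 1 + 0 *\<^sub>R m)) (at 0)"
    using has_vector_derivative_continuous[OF differential_line[of det "mat 1" m]]
    by (simp add: continuous_at)
  then have "\<forall>\<^sub>F t in at (0::real). det (mat 1 + t *\<^sub>R m) \<noteq> 0"
    by (rule tendsto_imp_eventually_ne) simp
  then have "\<forall>\<^sub>F t in nhds (0::real). det (mat 1 + t *\<^sub>R m) \<noteq> 0"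
    by (simp add: eventually_nhds_conv_at)
  then have "\<forall>\<^sub>F t in nhds (0::real). f (h + t *\<^sub>R (h ** m)) = 0"
  proof (rule eventually_mono)
    fix t :: real assume "det (mat 1 + t *\<^sub>R m) \<noteq> 0"
    then have "h ** (mat 1 + t *\<^sub>R m) \<in> frames X"
      using assms(3) frame_mult(1)[of h] frame_mult(2)[of h] by (simp add: frames_def)
    moreover have "h ** (mat 1 + t *\<^sub>R m) = h + t *\<^sub>R (h ** m)"
      by (simp add: matrix_add_ldistrib scaleR_eq_cscale mult_cscale)
    ultimately show "f (h + t *\<^sub>R (h ** m)) = 0"
      using assms(2) by simp
  qed
  then have "differential f h (h ** m) = differential (\<lambda>A :: complex^'r^'n. 0) 0 (0 :: complex^'r^'n)"
    by (intro differential_cong_line assms(1) poly_fun.const)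
  then show ?thesis
    by (simp add: differential_const)
qed

section \<open>Smoothness and conormal forms of the cone and of the subvariety\<close>

definition linear_form :: "(complex^'m^'k \<Rightarrow> complex) \<Rightarrow> bool" where
  "linear_form l \<longleftrightarrow> poly_fun l \<and> (\<forall>A B. l (A + B) = l A + l B) \<and> (\<forall>c A. l (cscale c A) = c * l A)"

lemma differential_linear_form:
  assumes "linear_form l"
  shows "differential l A v = l v"
proof -
  have l: "poly_fun l" "\<And>A B. l (A + B) = l A + l B" "\<And>c A. l (cscale c A) = c * l A"
    using assms by (auto simp: linear_form_def)
  have "((\<lambda>t::real. l A + of_real t * l v) has_vector_derivative differential l A v) (at 0)"
    using differential_line[OF l(1), of A v] by (simp add: l(2,3) scaleR_eq_cscale)
  moreover have "((\<lambda>t::real. l A + of_real t * l v) has_vector_derivative l v) (at 0)"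
    by (auto intro!: derivative_eq_intros)
  ultimately show ?thesis
    using vector_derivative_unique_at by blast
qed

text \<open>
  Go through the equations and keep one only if it does not vanish on the common zeros of those kept
  so far; a relation evaluated at a witness then has zero coefficient at the last one.
\<close>

lemma independent_linear_equations:
  fixes \<Lambda> :: "(complex^'m^'k \<Rightarrow> complex) set"
  assumes "finite \<Lambda>" "\<forall>l\<in>\<Lambda>. linear_form l"
  shows "\<exists>B\<subseteq>\<Lambda>. (\<forall>A. (\<forall>l\<in>B. l A = 0) \<longrightarrow> (\<forall>l\<in>\<Lambda>. l A = 0)) \<and>
    (\<forall>c. (\<forall>A. (\<Sum>l\<in>B. c l * l A) = 0) \<longrightarrow> (\<forall>l\<in>B. c l = 0))"
  using assms
proof (induction \<Lambda>)
  case empty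
  show ?case by simp
next
  case (insert m \<Lambda>)
  then have "\<forall>l\<in>\<Lambda>. linear_form l"
    by blast
  from insert.IH[OF this] obtain B
    where "B \<subseteq> \<Lambda> \<and> (\<forall>A. (\<forall>l\<in>B. l A = 0) \<longrightarrow> (\<forall>l\<in>\<Lambda>. l A = 0)) \<and>
      (\<forall>c. (\<forall>A. (\<Sum>l\<in>B. c l * l A) = 0) \<longrightarrow> (\<forall>l\<in>B. c l = 0))" ..
  then have B: "B \<subseteq> \<Lambda>" "\<And>A. \<forall>l\<in>B. l A = 0 \<Longrightarrow> \<forall>l\<in>\<Lambda>. l A = 0"
    "\<And>c. \<forall>A. (\<Sum>l\<in>B. c l * l A) = 0 \<Longrightarrow> \<forall>l\<in>B. c l = 0"
    by blast+
  show ?case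
  proof (cases "\<forall>A. (\<forall>l\<in>B. l A = 0) \<longrightarrow> m A = 0")
    case True
    then show ?thesis
      using B by (intro exI[of _ B]) blast
  next
    case False
    then obtain A where A: "\<forall>l\<in>B. l A = 0" "m A \<noteq> 0"
      by blast
    have fin: "finite B" "m \<notin> B"
      using B(1) insert.hyps finite_subset by blast+
    have "\<forall>l\<in>insert m B. c l = 0" if *: "\<forall>A. (\<Sum>l\<in>insert m B. c l * l A) = 0" for c
    proof -
      have split: "c m * m A + (\<Sum>l\<in>B. c l * l A) = 0" for A
        using * fin by simp
      then have "c m = 0"
        using split[of A] A by (simp add: sum.neutral)
      then show ?thesis
        using split B(3) by simp
    qed
    then show ?thesis
      using B by (intro exI[of _ "insert m B"]) blast
  qed
qed

text \<open>
  The definition of a smooth point uses a set of polynomials. Independence makes an indexed family of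
  equations injective, so that families, here indexed by a disjoint sum, may be used instead.
\<close>

lemma smooth_point_family:
  fixes S :: "(complex^'m^'k) set"
  assumes "A \<in> S" "openin zariski U" "A \<in> U" "finite I" "\<And>i. i \<in> I \<Longrightarrow> poly_fun (G i)"
    "S \<inter> U = {B \<in> U. \<forall>i\<in>I. G i B = 0}"
    "\<And>c i. \<lbrakk>\<And>v. (\<Sum>i\<in>I. c i * differential (G i) A v) = 0; i \<in> I\<rbrakk> \<Longrightarrow> c i = (0 :: complex)"
  shows "smooth_point S A"
proof -
  have inj: "inj_on G I"
  proof (rule inj_onI, rule ccontr)
    fix i j assume ij: "i \<in> I" "j \<in> I" "G i = G j" "i \<noteq> j"
    let ?c = "\<lambda>k. if k = i then 1 else if k = j then - 1 else 0 :: complex"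
    have "(\<Sum>k\<in>I. ?c k * differential (G k) A v) = 0" for v
    proof -
      have "(\<Sum>k\<in>I. ?c k * differential (G k) A v) = (\<Sum>k\<in>{i, j}. ?c k * differential (G k) A v)"
        using assms(4) ij by (intro sum.mono_neutral_right) auto
      then show ?thesis
        using ij by simp
    qed
    then have "?c i = 0"
      using assms(7)[of ?c i] ij(1) by blast
    then show False by simp
  qed
  show ?thesis
    unfolding smooth_point_def
  proof (intro conjI exI allI impI)
    fix c assume c: "\<forall>v. (\<Sum>f\<in>G ` I. c f * differential f A v) = 0"
    have "c (G i) = 0" if "i \<in> I" for i
      by (rule assms(7)[of "\<lambda>i. c (G i)"]) (use c inj that in \<open>simp_all add: sum.reindex\<close>)
    then show "\<forall>f\<in>G ` I. c f = 0"
      by blast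
  qed (use assms in auto)
qed

lemma differential_pullback:
  fixes h :: "complex^'r^'n"
  assumes "poly_fun f"
  shows "differential (\<lambda>A. f (B + A ** h)) 0 A = differential f B (A ** h)"
proof (rule differential_cong_line)
  show "poly_fun (\<lambda>A. f (B + A ** h))"
    by (rule poly_fun_compose[OF assms]) (intro poly_map_intros)
  show "\<forall>\<^sub>F t in nhds (0::real). f (B + (0 + t *\<^sub>R A) ** h) = f (B + t *\<^sub>R (A ** h))"
    by (simp add: scaleR_eq_cscale cscale_mult)
qed (rule assms)

text \<open>
  The map \<open>g A = h + A h\<close> embeds the chart space as a slice transversal to the orbit of \<open>h\<close>, and \<open>X\<close> in
  the chart is the preimage of the cone. Local equations of the cone therefore pull back to equations
  of \<open>X\<close>, to which linear equations of the chart space inside \<open>End(V)\<close> are added. The pulled back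
  equations stay independent on the chart space because the differentials of the original ones vanish
  in the orbit directions \<open>h m\<close>, which together with the slice span everything.
\<close>

lemma smooth_frame_smooth_image:
  fixes h :: "complex^'r^'n"
  assumes X: "closedin (grass_zariski CARD('r)) X" and h: "h \<in> frames X"
    and sm: "smooth_point (zariski_hull (frames X)) h"
  shows "smooth_gr X (range ((*v) h))"
proof -
  obtain p :: "complex^'n^'r" where p: "p ** h = mat 1"
    using h full_rank_iff_left_inverse by (auto simp: frames_def)
  let ?L = "range ((*v) h)" and ?W = "kernel p" and ?C = "zariski_hull (frames X) :: (complex^'r^'n) set"
  obtain U F where "openin zariski U \<and> h \<in> U \<and> finite F \<and> (\<forall>f\<in>F. poly_fun f) \<and>
      ?C \<inter> U = {B \<in> U. \<forall>f\<in>F. f B = 0} \<and>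
      (\<forall>c. (\<forall>v. (\<Sum>f\<in>F. c f * differential f h v) = 0) \<longrightarrow> (\<forall>f\<in>F. c f = 0))"
    using sm[unfolded smooth_point_def] by (elim conjE exE) (rule that, intro conjI)
  then have U: "openin zariski U" "h \<in> U" and F: "finite F" "\<And>f. f \<in> F \<Longrightarrow> poly_fun f"
    and eq: "?C \<inter> U = {B \<in> U. \<forall>f\<in>F. f B = 0}"
    and indep: "\<And>c f. \<lbrakk>\<And>v. (\<Sum>f\<in>F. c f * differential f h v) = 0; f \<in> F\<rbrakk> \<Longrightarrow> c f = 0"
    by blast+
  obtain S where S: "\<And>f. f \<in> S \<Longrightarrow> poly_fun f" "U = {A. \<exists>f\<in>S. f A \<noteq> 0}"
    using U(1) unfolding openin_zariski by blast
  define g where "g A = h + A ** h" for A :: "complex^'n^'n"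
  have g: "poly_map g"
    unfolding g_def by (intro poly_map_intros)
  define \<Lambda>0 where "\<Lambda>0 = (\<Union>i j. {\<lambda>A :: complex^'n^'n. (p ** A) $ i $ j}) \<union>
     (\<Union>i j. {\<lambda>A :: complex^'n^'n. (A - A ** h ** p) $ i $ j})"
  have "linear_form (\<lambda>A :: complex^'n^'n. (p ** A) $ i $ j)"
      "linear_form (\<lambda>A :: complex^'n^'n. (A - A ** h ** p) $ i' $ j)" for i i' j
  proof -
    have "poly_map (\<lambda>A :: complex^'n^'n. p ** A)" "poly_map (\<lambda>A :: complex^'n^'n. A - A ** h ** p)"
      by (intro poly_map_intros)+
    then show "linear_form (\<lambda>A :: complex^'n^'n. (p ** A) $ i $ j)"
      "linear_form (\<lambda>A :: complex^'n^'n. (A - A ** h ** p) $ i' $ j)"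
      by (auto simp: linear_form_def poly_map_def matrix_distribs mult_cscale cscale_mult[symmetric])
        (auto simp: cscale_def algebra_simps)
  qed
  then have lin0: "\<forall>l\<in>\<Lambda>0. linear_form l"
    by (auto simp: \<Lambda>0_def)
  have zero0: "(\<forall>l\<in>\<Lambda>0. l A = 0) \<longleftrightarrow> A \<in> chart_space ?L ?W" for A
  proof -
    have "(\<forall>l\<in>\<Lambda>0. l A = 0) \<longleftrightarrow> (\<forall>i j. (p ** A) $ i $ j = 0) \<and> (\<forall>i j. (A - A ** h ** p) $ i $ j = 0)"
      unfolding \<Lambda>0_def ball_Un ball_UN by simp
    then show ?thesis
      unfolding chart_space_iff[OF p] by (simp add: vec_eq_iff)
  qed
  have "finite \<Lambda>0"
    by (simp add: \<Lambda>0_def)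
  from independent_linear_equations[OF this lin0] obtain \<Lambda>
    where "\<Lambda> \<subseteq> \<Lambda>0 \<and> (\<forall>A. (\<forall>l\<in>\<Lambda>. l A = 0) \<longrightarrow> (\<forall>l\<in>\<Lambda>0. l A = 0)) \<and>
      (\<forall>c. (\<forall>A. (\<Sum>l\<in>\<Lambda>. c l * l A) = 0) \<longrightarrow> (\<forall>l\<in>\<Lambda>. c l = 0))" ..
  then have \<Lambda>: "\<Lambda> \<subseteq> \<Lambda>0" "\<And>A. \<forall>l\<in>\<Lambda>. l A = 0 \<Longrightarrow> \<forall>l\<in>\<Lambda>0. l A = 0"
      "\<And>c. \<forall>A. (\<Sum>l\<in>\<Lambda>. c l * l A) = 0 \<Longrightarrow> \<forall>l\<in>\<Lambda>. c l = 0"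
    by blast+
  have lin: "linear_form l" if "l \<in> \<Lambda>" for l
    using lin0 \<Lambda>(1) that by blast
  have zero: "(\<forall>l\<in>\<Lambda>. l A = 0) \<longleftrightarrow> A \<in> chart_space ?L ?W" for A
    using zero0 \<Lambda>(1,2) by blast
  have chart: "A \<in> in_chart X ?L ?W \<longleftrightarrow> g A \<in> ?C" if "A \<in> chart_space ?L ?W" for A
  proof -
    have "p ** g A = mat 1"
      using that chart_space_iff[OF p, of A] by (simp add: g_def matrix_distribs p matrix_mul_assoc)
    then have "map_rank (g A) = CARD('r)"
      using full_rank_iff_left_inverse by blast
    then have "g A \<in> ?C \<longleftrightarrow> range ((*v) (g A)) \<in> X"
      using frames_closed[OF X, of "g A"] zariski_hull_superset[of "frames X"] by (auto simp: frames_def)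
    then show ?thesis
      using that by (simp add: in_chart_def chart_range g_def)
  qed
  define G :: "(complex^'r^'n \<Rightarrow> complex) + (complex^'n^'n \<Rightarrow> complex) \<Rightarrow> complex^'n^'n \<Rightarrow> complex"
    where "G = case_sum (\<lambda>f A. f (g A)) (\<lambda>l. l)"
  let ?I = "F <+> \<Lambda>" and ?V = "{A. g A \<in> U}"
  have "smooth_point (in_chart X ?L ?W) 0"
  proof (rule smooth_point_family[where I = ?I and G = G and U = ?V])
    show "0 \<in> in_chart X ?L ?W"
      using origin_in_chart[OF subspace_kernel] h by (auto simp: frames_def)
    show "openin zariski ?V"
      unfolding openin_zariski S(2)
      by (intro exI[of _ "(\<lambda>f A. f (g A)) ` S"]) (auto intro: poly_fun_compose[OF S(1) g])
    show "0 \<in> ?V"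
      using U(2) by (simp add: g_def)
    show "finite ?I"
      using F(1) finite_subset[OF \<Lambda>(1) \<open>finite \<Lambda>0\<close>] by simp
    show "poly_fun (G i)" if "i \<in> ?I" for i
      using that lin poly_fun_compose[OF F(2) g] by (auto simp: G_def linear_form_def)
    show "in_chart X ?L ?W \<inter> ?V = {B \<in> ?V. \<forall>i\<in>?I. G i B = 0}"
    proof (intro set_eqI)
      fix A
      have "(\<forall>i\<in>?I. G i A = 0) \<longleftrightarrow> (\<forall>f\<in>F. f (g A) = 0) \<and> A \<in> chart_space ?L ?W"
        unfolding zero[symmetric] by (simp add: G_def Plus_def ball_Un)
      moreover have "A \<in> in_chart X ?L ?W \<Longrightarrow> A \<in> chart_space ?L ?W"
        by (simp add: in_chart_def)
      moreover have "g A \<in> ?C \<longleftrightarrow> (\<forall>f\<in>F. f (g A) = 0)" if "g A \<in> U"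
        using eq that by blast
      ultimately show "A \<in> in_chart X ?L ?W \<inter> ?V \<longleftrightarrow> A \<in> {B \<in> ?V. \<forall>i\<in>?I. G i B = 0}"
        using chart by blast
    qed
    show "c i = 0" if rel: "\<And>v. (\<Sum>i\<in>?I. c i * differential (G i) 0 v) = 0" and "i \<in> ?I" for c i
    proof -
      have dF: "differential (G (Inl f)) 0 A = differential f h (A ** h)" if "f \<in> F" for f A
        using differential_pullback[OF F(2)[OF that]] by (simp add: G_def g_def)
      have split: "(\<Sum>f\<in>F. c (Inl f) * differential f h (A ** h)) + (\<Sum>l\<in>\<Lambda>. c (Inr l) * l A) = 0" for A
      proof -
        have fin: "finite \<Lambda>"
          using finite_subset[OF \<Lambda>(1) \<open>finite \<Lambda>0\<close>] .
        have "(\<Sum>i\<in>?I. c i * differential (G i) 0 A)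
            = (\<Sum>f\<in>F. c (Inl f) * differential (G (Inl f)) 0 A) + (\<Sum>l\<in>\<Lambda>. c (Inr l) * differential (G (Inr l)) 0 A)"
          using F(1) fin by (simp add: sum.Plus)
        also have "\<dots> = (\<Sum>f\<in>F. c (Inl f) * differential f h (A ** h)) + (\<Sum>l\<in>\<Lambda>. c (Inr l) * l A)"
          using dF differential_linear_form[OF lin] by (simp add: G_def)
        finally show ?thesis
          using rel by simp
      qed
      have "c (Inl f) = 0" if "f \<in> F" for f
      proof (rule indep[of "\<lambda>f. c (Inl f)", OF _ that])
        fix v :: "complex^'r^'n"
        \<comment> \<open>Split \<open>v\<close> into its component along the orbit and its component \<open>A h\<close> in the slice.\<close>
        define A where "A = (v - h ** (p ** v)) ** p"
        have Ah: "A ** h = v - h ** (p ** v)"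
          by (simp add: A_def p matrix_mul_assoc[symmetric])
        have "A \<in> chart_space ?L ?W"
          unfolding chart_space_iff[OF p] Ah
          by (simp add: A_def matrix_distribs matrix_mul_assoc p)
        then have "\<forall>l\<in>\<Lambda>. l A = 0"
          using zero by blast
        then have "(\<Sum>l\<in>\<Lambda>. c (Inr l) * l A) = 0"
          by (simp add: sum.neutral)
        then have "(\<Sum>f\<in>F. c (Inl f) * differential f h (v - h ** (p ** v))) = 0"
          using split[of A] Ah by simp
        moreover have "differential f h (v - h ** (p ** v)) = differential f h v" if "f \<in> F" for f
        proof -
          \<comment> \<open>Inside \<open>U\<close> the polynomial \<open>f\<close> vanishes on the cone; the factor \<open>u\<close> makes it vanish everywhere on it.\<close>
          obtain u where u: "u \<in> S" "u h \<noteq> 0"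
            using U(2) S(2) by blast
          have pu: "poly_fun u" "poly_fun f"
            using S(1) F(2) u(1) that by blast+
          have "u B * f B = 0" if "B \<in> frames X" for B
          proof (cases "u B = 0")
            case False
            then have "B \<in> ?C \<inter> U"
              using that S(2) u(1) zariski_hull_superset by blast
            then show ?thesis
              using eq \<open>f \<in> F\<close> by simp
          qed simp
          then have "differential (\<lambda>B. u B * f B) h (h ** (p ** v)) = 0"
            using differential_along_fibre[OF poly_fun.mult[OF pu] _ h] by blast
          moreover have "f h = 0"
            using eq that U(2) h zariski_hull_superset by blast
          ultimately have "differential f h (h ** (p ** v)) = 0"
            using u(2) differential_mult[OF pu] by simp
          then show ?thesis
            using linear_diff[OF linear_differential[OF pu(2)]] by simp
        qed
        ultimately show "(\<Sum>f\<in>F. c (Inl f) * differential f h v) = 0"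
          by simp
      qed
      moreover from this have "\<forall>l\<in>\<Lambda>. c (Inr l) = 0"
        using split \<Lambda>(3)[of "\<lambda>l. c (Inr l)"] by simp
      ultimately show "c i = 0"
        using \<open>i \<in> ?I\<close> by auto
    qed
  qed
  then show ?thesis
    unfolding smooth_gr_def using complementary_range_kernel[OF p] by blast
qed

text \<open>
  As \<open>g\<close> annihilates the matrices \<open>h m\<close>, it vanishes on the image \<open>L\<close> of \<open>h\<close>, so \<open>h g\<close> is a map from
  \<open>V/L\<close> to \<open>L\<close>. A tangent vector \<open>T\<close> of \<open>X\<close> lifts to the tangent vector \<open>T h\<close> of the cone, modulo
  matrices \<open>h m\<close>, and the trace of \<open>h g T\<close> is that of \<open>g T h\<close>.
\<close>

lemma conormal_of_cone:
  fixes h :: "complex^'r^'n" and g :: "complex^'n^'r"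
  assumes X: "closedin (grass_zariski CARD('r)) X" and h: "h \<in> frames X"
    and sm: "smooth_point (zariski_hull (frames X)) h"
    and g: "\<forall>v\<in>tangent_space (zariski_hull (frames X)) h. trace (g ** v) = 0"
  shows "(range ((*v) h), h ** g) \<in> conormal X"
proof -
  obtain p :: "complex^'n^'r" where p: "p ** h = mat 1"
    using h full_rank_iff_left_inverse by (auto simp: frames_def)
  let ?L = "range ((*v) h)" and ?C = "zariski_hull (frames X) :: (complex^'r^'n) set"
  have "h ** m \<in> tangent_space ?C h" for m
    unfolding tangent_space_def
    using differential_along_fibre[OF _ _ h] zariski_hull_superset[of "frames X"] by blast
  then have "trace (g ** h ** m) = trace (0 ** m)" for m :: "complex^'r^'r"
    using g by (simp add: matrix_mul_assoc[symmetric] trace_def)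
  then have gh: "g ** h = 0"
    by (rule trace_form_nondegenerate)
  have "trace ((h ** g) ** T) = 0" if "T \<in> tangent_gr X ?L" for T
  proof -
    obtain W A where W: "complementary ?L W" and A: "A \<in> tangent_space (in_chart X ?L W) 0"
      and T: "\<And>l. l \<in> ?L \<Longrightarrow> T *v l - A *v l \<in> ?L"
      using \<open>T \<in> tangent_gr X ?L\<close> by (auto simp: tangent_gr_def)
    have "A ** h \<in> tangent_space ?C h"
      unfolding tangent_space_def
    proof (intro CollectI allI impI; elim conjE)
      fix f assume f: "poly_fun f" "\<forall>B\<in>?C. f B = 0"
      have "f (h + B ** h) = 0" if B: "B \<in> in_chart X ?L W" for B
      proof -
        have "?L \<in> grass CARD('r)"
          using h range_in_grass[of h "CARD('r)"] by (simp add: frames_def)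
        then have "range ((*v) (h + B ** h)) \<in> grass CARD('r)"
          using chart_in_grass[OF _ W, of _ B] B by (simp add: in_chart_def chart_range)
        then have "h + B ** h \<in> frames X"
          using B by (simp add: frames_def map_rank_def grass_def in_chart_def chart_range)
        then show ?thesis
          using f(2) zariski_hull_superset by blast
      qed
      moreover have "poly_fun (\<lambda>A. f (h + A ** h))"
        by (rule poly_fun_compose[OF f(1)]) (intro poly_map_intros)
      ultimately have "differential (\<lambda>A. f (h + A ** h)) 0 A = 0"
        using A unfolding tangent_space_def by blast
      then show "differential f h (A ** h) = 0"
        using differential_pullback[OF f(1), of h h A] by metis
    qed
    then have "trace (g ** (A ** h)) = 0"
      using g by blast
    moreover have "T ** h = A ** h + h ** (p ** ((T - A) ** h))"
    proof -
      have "((T - A) ** h) *v v \<in> ?L" for v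
        using T[of "h *v v"] by (simp add: matrix_vector_mul_assoc[symmetric] matrix_vector_mult_diff_rdistrib)
      then have "h ** (p ** ((T - A) ** h)) = (T - A) ** h"
        using frame_mult_reproduces[OF p] by blast
      then show ?thesis
        by (simp add: matrix_distribs)
    qed
    then have "g ** (T ** h) = g ** (A ** h) + (g ** h) ** (p ** ((T - A) ** h))"
      by (simp add: matrix_add_ldistrib matrix_mul_assoc)
    ultimately have "trace (g ** (T ** h)) = 0"
      using gh by simp
    then show ?thesis
      using trace_mul_sym[of h "g ** T"] by (simp add: matrix_mul_assoc)
  qed
  moreover have "(h ** g) *v l = 0" if "l \<in> ?L" for l
  proof -
    obtain y where "l = h *v y"
      using \<open>l \<in> ?L\<close> by blast
    then have "(h ** g) *v l = h *v ((g ** h) *v y)"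
      by (simp add: matrix_vector_mul_assoc matrix_mul_assoc)
    then show ?thesis
      by (simp add: gh)
  qed
  moreover have "(h ** g) *v v \<in> ?L" for v
    by (simp add: matrix_vector_mul_assoc[symmetric])
  ultimately show ?thesis
    unfolding conormal_def using h smooth_frame_smooth_image[OF X h sm] by (simp add: frames_def)
qed

text \<open>
  Conversely, \<open>\<phi>\<close> is the differential at the origin of a polynomial \<open>f\<close> that vanishes on \<open>X\<close> in the
  chart. Composed with the rational chart coordinate of a frame and cleared of denominators, \<open>f\<close> becomes
  a polynomial \<open>Q\<close> that vanishes on the frames of \<open>X\<close>. On the slice through \<open>h\<close>, where \<open>p h' = 1\<close>, it
  agrees with \<open>f\<close>, and along the orbit its derivative is zero; hence its gradient at \<open>h\<close> is \<open>p \<phi>\<close>.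
\<close>

lemma conormal_lifts_to_cone:
  fixes X :: "(complex^'n) set set"
  assumes sub: "X \<subseteq> grass CARD('r)" and con: "(L, \<phi>) \<in> conormal X"
  obtains h :: "complex^'r^'n" and q where "h \<in> frames X" "poly_fun q" "\<forall>B\<in>frames X. q B = 0"
    "h ** gradient q h = \<phi>"
proof -
  have L: "L \<in> X" and \<phi>: "\<And>l. l \<in> L \<Longrightarrow> \<phi> *v l = 0" "\<And>v. \<phi> *v v \<in> L"
    and perp: "\<And>T. T \<in> tangent_gr X L \<Longrightarrow> trace (\<phi> ** T) = 0"
    using con by (auto simp: conormal_def)
  obtain h :: "complex^'r^'n" where h: "map_rank h = CARD('r)" "range ((*v) h) = L"
    using grass_frame sub L by blast
  then have "h \<in> frames X"
    using L by (simp add: frames_def)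
  obtain p :: "complex^'n^'r" where p: "p ** h = mat 1"
    using h full_rank_iff_left_inverse by blast
  have W: "complementary L (kernel p)"
    using complementary_range_kernel[OF p] h(2) by simp
  have "0 \<in> L"
    using W vec.subspace_0 by (auto simp: complementary_def)
  then have "A \<in> tangent_gr X L" if "A \<in> tangent_space (in_chart X L (kernel p)) 0" for A
    unfolding tangent_gr_def using that W by (intro CollectI exI[of _ "kernel p"] conjI bexI[of _ A]) auto
  then obtain f where f: "poly_fun f" "\<forall>B\<in>in_chart X L (kernel p). f B = 0" "gradient f 0 = \<phi>"
    using conormal_is_gradient[of "in_chart X L (kernel p)" 0 \<phi>] perp by blast
  define s where "s h' = det (p ** h')" for h' :: "complex^'r^'n"
  define N where "N h' = (mat 1 - h ** p) ** h' ** adjugate (p ** h') ** p" for h' :: "complex^'r^'n"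
  have s: "poly_fun s"
    unfolding s_def by (intro poly_fun_det poly_map_intros)
  have N: "poly_map N"
    unfolding N_def by (intro poly_map_intros)
  obtain e q where q: "poly_fun q" "\<And>h'. s h' \<noteq> 0 \<Longrightarrow> q h' = s h' ^ e * f (cscale (1 / s h') (N h'))"
    using clear_denominator[OF f(1) N s] by blast
  have coord: "(p ** h') ** cscale (1 / s h') (adjugate (p ** h')) = mat 1"
    "cscale (1 / s h') (N h') = (mat 1 - h ** p) ** h' ** cscale (1 / s h') (adjugate (p ** h')) ** p"
    if "s h' \<noteq> 0" for h'
    using mult_adjugate that by (simp_all add: s_def N_def mult_cscale cscale_mult[symmetric])
  \<comment> \<open>The additional factor \<open>s\<close> makes \<open>Q\<close> vanish also on the frames outside the chart, where \<open>q\<close> is not controlled.\<close>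
  define Q where "Q h' = s h' * q h'" for h'
  have Q: "poly_fun Q"
    unfolding Q_def using s q(1) by (rule poly_fun.mult)
  have Q0: "Q h' = 0" if h': "h' \<in> frames X" for h'
  proof (cases "s h' = 0")
    case False
    have "cscale (1 / s h') (N h') \<in> in_chart X L (kernel p)"
      unfolding coord(2)[OF False] in_chart_def
      using frame_in_chart(1,2)[OF p coord(1)[OF False]] h' h(2) by (simp add: frames_def)
    then show ?thesis
      using q(2)[OF False] f(2) by (simp add: Q_def)
  qed (simp add: Q_def)
  have \<phi>h: "\<phi> ** h = 0"
    by (rule matrix_eqI) (use \<phi>(1) h(2) in \<open>auto simp: matrix_vector_mul_assoc[symmetric]\<close>)
  have "gradient Q h = p ** \<phi>"
  proof (rule trace_form_nondegenerate)
    fix v :: "complex^'r^'n"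
    \<comment> \<open>Only the component \<open>w\<close> of \<open>v\<close> in the slice contributes.\<close>
    define w where "w = v - h ** (p ** v)"
    have pw: "p ** w = 0"
      by (simp add: w_def matrix_distribs matrix_mul_assoc p)
    have "Q (h + t *\<^sub>R w) = f (0 + t *\<^sub>R (w ** p))" for t :: real
    proof -
      have ph: "p ** (h + t *\<^sub>R w) = mat 1"
        by (simp add: scaleR_eq_cscale matrix_distribs mult_cscale p pw)
      then have s1: "s (h + t *\<^sub>R w) = 1"
        by (simp add: s_def)
      have "cscale 1 (adjugate (p ** (h + t *\<^sub>R w))) = mat 1"
        using coord(1)[of "h + t *\<^sub>R w"] s1 ph by simp
      then have "cscale 1 (N (h + t *\<^sub>R w)) = (mat 1 - h ** p) ** (h + t *\<^sub>R w) ** p"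
        using coord(2)[of "h + t *\<^sub>R w"] s1 by simp
      also have "(mat 1 - h ** p) ** (h + t *\<^sub>R w) = t *\<^sub>R w"
        using ph by (simp add: matrix_diff_mult matrix_mul_assoc[symmetric])
      finally show ?thesis
        using q(2)[of "h + t *\<^sub>R w"] s1 by (simp add: Q_def scaleR_eq_cscale cscale_mult)
    qed
    then have "differential Q h w = differential f 0 (w ** p)"
      by (intro differential_cong_line Q f(1) always_eventually) simp
    also have "\<dots> = trace (\<phi> ** (w ** p))"
      using trace_gradient[OF f(1), of 0] f(3) by simp
    also have "\<dots> = trace (p ** \<phi> ** w)"
      using trace_mul_sym[of "\<phi> ** w" p] by (simp add: matrix_mul_assoc)
    also have "p ** \<phi> ** w = p ** \<phi> ** v"
    proof -
      have "p ** \<phi> ** w = p ** \<phi> ** v - p ** (\<phi> ** h) ** (p ** v)"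
        by (simp add: w_def matrix_mult_diff matrix_mul_assoc)
      then show ?thesis
        by (simp add: \<phi>h)
    qed
    finally have "differential Q h w = trace (p ** \<phi> ** v)" .
    moreover have "differential Q h w = differential Q h v - differential Q h (h ** (p ** v))"
      unfolding w_def using linear_diff[OF linear_differential[OF Q]] .
    moreover have "differential Q h (h ** (p ** v)) = 0"
      using differential_along_fibre[OF Q _ \<open>h \<in> frames X\<close>] Q0 by blast
    ultimately show "trace (gradient Q h ** v) = trace (p ** \<phi> ** v)"
      using trace_gradient[OF Q] by simp
  qed
  moreover have "h ** (p ** \<phi>) = \<phi>"
    using frame_mult_reproduces[OF p] \<phi>(2) h(2) by blast
  ultimately show thesis
    using that[OF \<open>h \<in> frames X\<close> Q] Q0 by simp
qed

section \<open>The dual variety of the cone\<close>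

lemma frames_nonzero:
  fixes h :: "complex^'r^'n"
  assumes "h \<in> frames X"
  shows "h \<noteq> 0"
proof
  assume "h = 0"
  then obtain p :: "complex^'n^'r" where "p ** (0 :: complex^'r^'n) = mat 1"
    using assms full_rank_iff_left_inverse[of h] by (auto simp: frames_def)
  then have "(0 :: complex^'r^'r) $ i $ i = mat 1 $ i $ i" for i
    by simp
  then show False
    by (simp add: mat_def)
qed

lemma frames_cscale:
  fixes h :: "complex^'r^'n"
  assumes "c \<noteq> 0" "h \<in> frames X"
  shows "cscale c h \<in> frames X"
proof -
  have "cscale c (mat 1) ** cscale (1 / c) (mat 1) = (mat 1 :: complex^'r^'r)"
    using assms(1) by (simp add: mult_cscale cscale_eq_mult)
  then have "range ((*v) (h ** cscale c (mat 1))) = range ((*v) h)"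
    by (rule range_mult_invertible)
  then show ?thesis
    using assms(2) by (simp add: mult_cscale frames_def map_rank_def)
qed

lemma pi_preimage_iff:
  fixes h :: "complex^'r^'n"
  assumes "h \<noteq> 0"
  shows "proj_class h \<in> pi_preimage X \<longleftrightarrow> h \<in> frames X"
proof
  assume "proj_class h \<in> pi_preimage X"
  then obtain k :: "complex^'r^'n" where k: "proj_class h = proj_class k" "k \<in> frames X"
    by (auto simp: pi_preimage_def frames_def)
  then show "h \<in> frames X"
    using proj_class_eq[OF k(1) assms] frames_cscale by metis
next
  assume "h \<in> frames X"
  then show "proj_class h \<in> pi_preimage X"
    by (auto simp: pi_preimage_def frames_def)
qed

text \<open>
  Away from the origin this compares the two Zariski topologies. The origin belongs to the cone by
  definition, and to the hull because a polynomial that vanishes on a nonempty set closed under nonzero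
  scalars vanishes at the origin.
\<close>

lemma affine_cone_closure_pi_preimage:
  fixes X :: "(complex^'n) set set"
  assumes "(frames X :: (complex^'r^'n) set) \<noteq> {}"
  shows "affine_cone (proj_zariski closure_of (pi_preimage X :: (complex^'r^'n) set set)) = zariski_hull (frames X)"
proof (intro set_eqI)
  fix A :: "complex^'r^'n"
  show "A \<in> affine_cone (proj_zariski closure_of (pi_preimage X)) \<longleftrightarrow> A \<in> zariski_hull (frames X)"
  proof (cases "A = 0")
    case False
    have "(\<forall>B. B \<noteq> 0 \<and> proj_class B \<in> pi_preimage X \<longrightarrow> f B = 0) \<longleftrightarrow> (\<forall>B\<in>frames X. f B = 0)"
      for f :: "complex^'r^'n \<Rightarrow> complex"
      using pi_preimage_iff frames_nonzero by blast
    then show ?thesis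
      using False proj_closure_iff[OF False, of "pi_preimage X"] by (simp add: affine_cone_def zariski_hull_def)
  next
    case True
    have "f 0 = 0" if f: "poly_fun f" "\<forall>B\<in>frames X. f B = 0" for f :: "complex^'r^'n \<Rightarrow> complex"
    proof (rule ccontr)
      assume "f 0 \<noteq> 0"
      from homogeneous_components[OF f(1) this] obtain f' where f': "hom_poly f'" "f' 0 \<noteq> 0"
        "\<forall>B. (\<forall>c. c \<noteq> 0 \<longrightarrow> f (cscale c B) = 0) \<longrightarrow> f' B = 0"
        by blast
      obtain h :: "complex^'r^'n" where h: "h \<in> frames X"
        using assms by blast
      have "f' h = 0"
        using f'(3) frames_cscale[OF _ h] f(2) by blast
      then have "f' (cscale 0 h) = 0"
        using f'(1) unfolding hom_poly_def by (metis mult_zero_right)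
      then show False
        using f'(2) by simp
    qed
    then show ?thesis
      using True by (simp add: affine_cone_def zariski_hull_def)
  qed
qed

text \<open>
  The conormal condition is invariant under scaling, so membership in the dual variety can be tested
  with arbitrary polynomials on the forms themselves.
\<close>

lemma proj_dual_iff:
  fixes g :: "complex^'k^'m"
  assumes "g \<noteq> 0"
  shows "proj_class g \<in> proj_dual Z \<longleftrightarrow>
    (\<forall>w. poly_fun w \<and>
      (\<forall>g'. g' \<noteq> 0 \<and> (\<exists>h. h \<noteq> 0 \<and> smooth_point (affine_cone Z) h \<and>
         (\<forall>v\<in>tangent_space (affine_cone Z) h. trace (g' ** v) = 0)) \<longrightarrow> w g' = 0) \<longrightarrow> w g = 0)"
proof -
  let ?P = "\<lambda>g :: complex^'k^'m. \<exists>h. h \<noteq> 0 \<and> smooth_point (affine_cone Z) h \<and>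
     (\<forall>v\<in>tangent_space (affine_cone Z) h. trace (g ** v) = 0)"
  have "proj_class B \<in> {proj_class g | g. g \<noteq> 0 \<and> ?P g} \<longleftrightarrow> ?P B" if B: "B \<noteq> 0" for B
  proof
    assume "proj_class B \<in> {proj_class g | g. g \<noteq> 0 \<and> ?P g}"
    then obtain g where g: "proj_class B = proj_class g" "?P g"
      by blast
    obtain c where "B = cscale c g"
      using proj_class_eq[OF g(1) B] .
    then show "?P B"
      using g(2) by (simp add: trace_mult_cscale) blast
  qed (use B in blast)
  then have "(\<forall>B. B \<noteq> 0 \<and> proj_class B \<in> {proj_class g | g. g \<noteq> 0 \<and> ?P g} \<longrightarrow> w B = 0) \<longleftrightarrow>
      (\<forall>B. B \<noteq> 0 \<and> ?P B \<longrightarrow> w B = 0)" for w :: "complex^'k^'m \<Rightarrow> complex"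
    by (intro iff_allI) (simp only: simp_thms cong: imp_cong conj_cong)
  then show ?thesis
    unfolding proj_dual_def proj_closure_iff[OF assms] by (simp only:)
qed

lemma map_rank_kernel_frame_mult:
  fixes h :: "complex^'r^'n" and g :: "complex^'m^'r"
  assumes "p ** h = mat 1"
  shows "map_rank (h ** g) = map_rank g" "kernel (h ** g) = kernel g"
proof -
  have inj: "inj ((*v) h)"
    using assms matrix_left_invertible_injective by blast
  have "range ((*v) (h ** g)) = (*v) h ` range ((*v) g)"
    by (auto simp: matrix_vector_mul_assoc[symmetric])
  then show "map_rank (h ** g) = map_rank g"
    unfolding map_rank_def
    using vec.dim_image_eq[OF matrix_vector_mul_linear_gen inj_on_subset[OF inj]] by simp
  have "h *v y = 0 \<longleftrightarrow> y = 0" for y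
    using inj by (metis injD matrix_vector_mult_0_right)
  then show "kernel (h ** g) = kernel g"
    by (simp add: kernel_def matrix_vector_mul_assoc[symmetric])
qed

theorem proposition1p4:
  fixes X :: "(complex^'n) set set"
  assumes "2 * CARD('r) < CARD('n)"
    and "suitable CARD('r) X"
  shows "dual_Q CARD('r) X =
    pi'_image (proj_dual (proj_zariski closure_of (pi_preimage X :: (complex^'r^'n) set set)))"
proof -
  define P where "P = (frames X :: (complex^'r^'n) set)"
  define Z where "Z = proj_zariski closure_of (pi_preimage X :: (complex^'r^'n) set set)"
  let ?T = "grass_zariski (CARD('n) - CARD('r)) :: (complex^'n) set topology"
  let ?S1 = "{kernel \<phi> | L \<phi>. (L, \<phi>) \<in> conormal X \<and> map_rank \<phi> = CARD('r)}"
  let ?S2 = "{kernel g | g :: complex^'n^'r. map_rank g = CARD('r) \<and> proj_class g \<in> proj_dual Z}"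
  have X: "closedin (grass_zariski CARD('r)) X" "irreducible_in (grass_zariski CARD('r)) X"
    using assms(2) by (auto simp: suitable_def)
  have sub: "X \<subseteq> grass CARD('r)"
    using closedin_subset[OF X(1)] by simp
  have prime: "prime_locus P"
    unfolding P_def using prime_locus_frames[OF X(2) sub] .
  then have cone: "affine_cone Z = zariski_hull P"
    unfolding Z_def P_def by (intro affine_cone_closure_pi_preimage) (simp add: prime_locus_def)
  have left_inverse: "\<exists>p :: complex^'n^'r. p ** h = mat 1" if "h \<in> P" for h
    using that full_rank_iff_left_inverse by (auto simp: P_def frames_def)
  have "?S1 \<subseteq> ?S2"
  proof (intro subsetI; elim CollectE exE conjE)
    fix K L \<phi> assume K: "K = kernel \<phi>" and \<phi>: "(L, \<phi>) \<in> conormal X" "map_rank \<phi> = CARD('r)"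
    obtain h :: "complex^'r^'n" and q where h: "h \<in> P" and q: "poly_fun q" "\<forall>B\<in>P. q B = 0" "h ** gradient q h = \<phi>"
      using conormal_lifts_to_cone[OF sub \<phi>(1)] unfolding P_def by blast
    define g where "g = gradient q h"
    have g: "map_rank g = CARD('r)" "kernel g = kernel \<phi>"
      using left_inverse[OF h] map_rank_kernel_frame_mult[where h = h and g = g] q(3) \<phi>(2) by (auto simp: g_def)
    have "g \<noteq> 0"
    proof
      assume "g = 0"
      then have "\<phi> = 0"
        using q(3) by (simp add: g_def)
      then show False
        using \<phi>(2) by (simp add: map_rank_def)
    qed
    have "proj_class g \<in> proj_dual Z"
      unfolding proj_dual_iff[OF \<open>g \<noteq> 0\<close>]
    proof (intro allI impI; elim conjE; rule ccontr)
      fix w :: "complex^'n^'r \<Rightarrow> complex"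
      assume w: "poly_fun w" "w g \<noteq> 0"
        "\<forall>g'. g' \<noteq> 0 \<and> (\<exists>h. h \<noteq> 0 \<and> smooth_point (affine_cone Z) h \<and>
         (\<forall>v\<in>tangent_space (affine_cone Z) h. trace (g' ** v) = 0)) \<longrightarrow> w g' = 0"
      \<comment> \<open>The factor \<open>g $ a $ b\<close> in the open condition keeps the perturbed form nonzero, so that it is a projective point.\<close>
      obtain a b where ab: "g $ a $ b \<noteq> 0"
        using \<open>g \<noteq> 0\<close> by (auto simp: vec_eq_iff)
      have wab: "poly_fun (\<lambda>g :: complex^'n^'r. w g * g $ a $ b)"
        using w(1) by (intro poly_fun_intros)
      obtain k where k: "k \<in> P" "smooth_point (zariski_hull P) k" "w (gradient q k) * gradient q k $ a $ b \<noteq> 0"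
        by (rule perturb_conormal[OF prime q(1) _ wab, of h])
          (use h zariski_hull_superset[of P] w(2) ab in \<open>auto simp: g_def\<close>)
      moreover have "trace (gradient q k ** v) = 0" if "v \<in> tangent_space (zariski_hull P) k" for v
        using gradient_is_conormal[OF q(1) zariski_hull_vanishes[OF q(1,2)] that] .
      moreover have "gradient q k \<noteq> 0" "k \<noteq> 0"
        using k(1,3) frames_nonzero by (auto simp: P_def)
      ultimately show False
        using w(3) unfolding cone by (metis mult_zero_left)
    qed
    then show "K \<in> ?S2"
      using g K by blast
  qed
  moreover have "?S2 \<subseteq> ?T closure_of ?S1"
  proof (intro subsetI; elim CollectE exE conjE)
    fix K and g :: "complex^'n^'r"
    assume K: "K = kernel g" and g: "map_rank g = CARD('r)" "proj_class g \<in> proj_dual Z"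
    have "g \<noteq> 0"
      using g(1) by (auto simp: map_rank_def)
    show "K \<in> ?T closure_of ?S1"
      unfolding in_closure_of
    proof (intro conjI allI impI)
      show "K \<in> topspace ?T"
        using kernel_in_grass[OF g(1)] K by simp
      fix U assume U: "K \<in> U \<and> openin ?T U"
      then obtain w where w: "poly_fun w" "w g \<noteq> 0"
        "\<And>g' :: complex^'n^'r. w g' \<noteq> 0 \<Longrightarrow> map_rank g' = CARD('r) \<and> kernel g' \<in> U"
        using kernel_continuous[OF _ g(1)] K by metis
      obtain g' h where g': "w g' \<noteq> 0" and h: "smooth_point (zariski_hull P) h"
        "\<forall>v\<in>tangent_space (zariski_hull P) h. trace (g' ** v) = 0"
        using g(2) w(1,2) unfolding proj_dual_iff[OF \<open>g \<noteq> 0\<close>] cone by blast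
      obtain q where q: "poly_fun q" "\<forall>B\<in>zariski_hull P. q B = 0" "gradient q h = g'"
        using conormal_is_gradient[OF h(2)] .
      have "h \<in> zariski_hull P"
        using h(1) by (simp add: smooth_point_def)
      then obtain k where k: "k \<in> P" "smooth_point (zariski_hull P) k" "w (gradient q k) \<noteq> 0"
        using perturb_conormal[OF prime q(1) _ w(1)] q(3) g' by metis
      \<comment> \<open>The condition \<open>w \<noteq> 0\<close> at the perturbed form makes it generic, with kernel in \<open>U\<close>.\<close>
      have "(range ((*v) k), k ** gradient q k) \<in> conormal X"
        using conormal_of_cone[OF X(1)] k(1,2) gradient_is_conormal[OF q(1,2)] unfolding P_def by blast
      moreover have "map_rank (k ** gradient q k) = CARD('r)" "kernel (k ** gradient q k) \<in> U"
        using left_inverse[OF k(1)] map_rank_kernel_frame_mult[where h = k and g = "gradient q k"] w(3)[OF k(3)]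
        by auto
      ultimately show "\<exists>y. y \<in> ?S1 \<and> y \<in> U"
        by blast
    qed
  qed
  ultimately have "?T closure_of ?S1 = ?T closure_of ?S2"
    by (meson closedin_closure_of closure_of_minimal closure_of_mono subset_antisym)
  then show ?thesis
    unfolding dual_Q_def pi'_image_def Z_def .
qed

end
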